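(* Let $W=w_1\oplus w_2\oplus\cdots\oplus w_N$ be a direct sum of classical scalar weights of the same type (all shifted Hermite, all Laguerre, or all Jacobi). Then $$\mathcal D(w_1\oplus\cdots\oplus w_N)=\sum_{i=1}^N\sum_{j=1}^N\mathcal T_{w_i,w_j}\cdot\mathcal D(w_j)\,E_{i,j},$$ where the operators $\mathcal T_{w_i,w_j}\in\Omega[x]$ are those defined in the context.
   Context: Classical scalar weights: shifted Hermite $w_b(x)=e^{-x^2+2bx}$ on $(-\infty,\infty)$, $b\in\mathbb R$; Laguerre $w_\alpha(x)=e^{-x}x^\alpha$ on $(0,\infty)$, $\alpha>-1$; Jacobi $w_{\alpha,\beta}(x)=(1-x)^\alpha(1+x)^\beta$ on $(-1,1)$, $\alpha,\beta>-1$. $W=w_1\oplus\cdots\oplus w_N$ is the diagonal weight matrix $\operatorname{diag}(w_1,\dots,w_N)$. $E_{i,j}$ is the $N\times N$ matrix with $(i,j)$-entry $1$ and $0$ elsewhere. Differential operators $D=\sum_j\partial^jF_j(x)$, $\partial=\frac d{dx}$, act on the right: $P(x)\cdot D=\sum_j\partial^j(P)(x)F_j(x)$ (so $p\cdot(\partial x)=p'(x)\,x$); products satisfy $P\cdot(D_1D_2)=(P\cdot D_1)\cdot D_2$. $\operatorname{Mat}_N(\Omega[x])$ denotes such operators with $F_j\in\operatorname{Mat}_N(\mathbb C)[x]$, and $\Omega[x]$ is the case $N=1$. For a weight matrix $W$ with monic (leading coefficient $I$) orthogonal polynomials $P_n$ (orthogonal for $\langle P,Q\rangle=\int P(x)W(x)Q(x)^*dx$),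 $\mathcal D(W)$ is the algebra of $D\in\operatorname{Mat}_N(\Omega[x])$ such that for all $n\ge0$, $P_n\cdot D=\Lambda_n(D)P_n$ for some $\Lambda_n(D)\in\operatorname{Mat}_N(\mathbb C)$; in particular $\mathcal D(w_j)\subset\Omega[x]$ is defined for scalar weights. An operator $\mathcal V$ is degree-preserving if $\deg(P\cdot\mathcal V)=\deg P$ for all polynomials $P$. For scalar weights $w,\widetilde w$ on the same interval with monic orthogonal polynomials $p_n,\widetilde p_n$, $\widetilde w$ is a Darboux transformation of $w$ if there is $D\in\mathcal D(w)$ with $D=\mathcal V\mathcal N$, where $\mathcal V,\mathcal N\in\Omega[x]$ are degree-preserving and $p_n\cdot\mathcal V=A_n\widetilde p_n$ for all $n\ge0$, for some $A_n\in\mathbb C$. The operators $\mathcal T_{w,w'}$ for classical scalar weights $w,w'$ of the same type: (i) $\mathcal T_{w,w'}=0$ if $w$ is not a Darboux transformation of $w'$; (ii) $\mathcal T_{w,w}=1$; (iii) for Laguerre weights and $k\in\mathbb N$, $\mathcal T_{w_\alpha,w_{\alpha+k}}=(\partial-1)^k$ and $\mathcal T_{w_{\alpha+k},w_\alpha}=\mathcal N_k\mathcal N_{k-1}\cdots\mathcal N_1$ with $\mathcal N_j=\partial x+\alpha+j$; (iv) for Jacobi weights and $k\in\mathbb N$, $\mathcal T_{w_{\alpha,\beta+k},w_{\alpha+k,\beta}}=\mathcal V_k\cdots\mathcal V_1$ with $\mathcal V_j=\partial(1+x)+\beta+j$, and $\mathcal T_{w_{\alpha+k,\beta},w_{\alpha,\beta+k}}=\mathcal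 M_k\cdots\mathcal M_1$ with $\mathcal M_j=\partial(x-1)+\alpha+j$. These cases cover all pairs, since Laguerre weights are Darboux transformations of each other exactly when their parameters differ by an integer, Jacobi weights $w_{\alpha,\beta},w_{\widetilde\alpha,\widetilde\beta}$ exactly when $\alpha+\beta=\widetilde\alpha+\widetilde\beta$ and $\alpha-\widetilde\alpha\in\mathbb Z$, and shifted Hermite weights exactly when they are equal. *)

theory Defs
  imports "HOL-Analysis.Analysis" "HOL-Computational_Algebra.Polynomial"
begin

section \<open>Scalar differential operators\<close>

text \<open>
  An element D of type \<open>diffop\<close> represents \<open>D = (\<Sum>j. \<partial>^j F_j(x))\<close>: the outer
  polynomial variable is \<open>\<partial>\<close> and \<open>coeff D j\<close> is \<open>F_j\<close>. Thus \<open>[:f, g:]\<close> is \<open>f(x) + \<partial> g(x)\<close>.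
  Addition, \<open>0\<close> and \<open>1\<close> of the polynomial type are those of operators, but the
  commutative multiplication \<open>*\<close> of the polynomial type is not the product of
  operators; that product is \<open>diffop_mult\<close> below.
\<close>

type_synonym diffop = "complex poly poly"

definition act :: "complex poly \<Rightarrow> diffop \<Rightarrow> complex poly" where
  "act p D = (\<Sum>j\<le>degree D. (pderiv ^^ j) p * coeff D j)"

text \<open>
  By the Leibniz rule \<open>(\<partial>^i f)(\<partial>^j g) = (\<Sum>l\<le>j. \<partial>^(i+l) (j choose l) f^(j-l) g)\<close> for
  operators acting on the right; \<open>act_diffop_mult\<close> is the defining property of the product.
\<close>

definition diffop_mult :: "diffop \<Rightarrow> diffop \<Rightarrow> diffop" (infixl "\<odot>" 70) where
  "D1 \<odot> D2 = (\<Sum>i\<le>degree D1. \<Sum>j\<le>degree D2. \<Sum>l\<le>j.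
      monom (of_nat (j choose l) * (pderiv ^^ (j - l)) (coeff D1 i) * coeff D2 j) (i + l))"

definition diffop_prod :: "diffop list \<Rightarrow> diffop" where
  "diffop_prod Ds = foldr (\<odot>) Ds 1"

lemma higher_pderiv_zero: "(pderiv ^^ n) (0 :: complex poly) = 0"
  by (induction n) simp_all

lemma act_bound:
  assumes "degree D \<le> n"
  shows "act p D = (\<Sum>j\<le>n. (pderiv ^^ j) p * coeff D j)"
  unfolding act_def
  by (rule sum.mono_neutral_left) (use assms in \<open>auto simp: coeff_eq_0\<close>)

lemma act_add_right: "act p (D1 + D2) = act p D1 + act p D2"
proof -
  define n where "n = max (degree D1) (degree D2)"
  have "degree (D1 + D2) \<le> n"
    unfolding n_def by (rule degree_add_le_max)
  then show ?thesis
    using act_bound[of D1 n p] act_bound[of D2 n p] act_bound[of "D1 + D2" n p]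
    by (simp add: n_def algebra_simps sum.distrib)
qed

lemma act_sum_right: "act p (sum D A) = (\<Sum>a\<in>A. act p (D a))"
proof (induction A rule: infinite_finite_induct)
  case (insert a A)
  then show ?case by (simp add: act_add_right)
qed (simp_all add: act_def)

lemma act_monom: "act p (monom f n) = (pderiv ^^ n) p * f"
proof -
  have "act p (monom f n) = (\<Sum>j\<le>n. (pderiv ^^ j) p * coeff (monom f n) j)"
    by (rule act_bound) (rule degree_monom_le)
  also have "\<dots> = (\<Sum>j\<in>{n}. (pderiv ^^ j) p * coeff (monom f n) j)"
    by (rule sum.mono_neutral_right) auto
  finally show ?thesis by simp
qed

lemma pderiv_sum: "pderiv (sum f A) = (\<Sum>a\<in>A. pderiv (f a :: complex poly))"
  by (induction A rule: infinite_finite_induct) (simp_all add: pderiv_add)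

lemma higher_pderiv_sum: "(pderiv ^^ n) (sum f A) = (\<Sum>a\<in>A. (pderiv ^^ n) (f a :: complex poly))"
  by (induction n) (simp_all add: pderiv_sum)

lemma higher_pderiv_mult:
  fixes p q :: "complex poly"
  shows "(pderiv ^^ n) (p * q) =
    (\<Sum>l\<le>n. of_nat (n choose l) * ((pderiv ^^ l) p * (pderiv ^^ (n - l)) q))"
proof (induction n)
  case (Suc n)
  have c: "pderiv (of_nat m * r) = of_nat m * pderiv r" for m and r :: "complex poly"
    by (simp add: of_nat_poly pderiv_smult)
  let ?a = "\<lambda>l. (pderiv ^^ l) p" and ?b = "\<lambda>l. (pderiv ^^ l) q"
  have "(pderiv ^^ Suc n) (p * q) =
      (\<Sum>l\<le>n. of_nat (n choose l) * (?a (Suc l) * ?b (n - l)) +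
         of_nat (n choose l) * (?a l * ?b (Suc n - l)))"
    unfolding funpow.simps(2) o_def Suc pderiv_sum c
    by (rule sum.cong) (simp_all add: pderiv_mult Suc_diff_le algebra_simps)
  also have "\<dots> = (\<Sum>l\<le>n. of_nat (n choose l) * (?a (Suc l) * ?b (n - l))) +
      (\<Sum>l\<le>Suc n. of_nat (n choose l) * (?a l * ?b (Suc n - l)))"
    by (simp add: sum.distrib)
  also have "(\<Sum>l\<le>Suc n. of_nat (n choose l) * (?a l * ?b (Suc n - l))) = p * ?b (Suc n) +
      (\<Sum>l\<le>n. of_nat (n choose Suc l) * (?a (Suc l) * ?b (n - l)))"
    by (subst sum.atMost_Suc_shift) simp
  finally show ?case
    by (subst sum.atMost_Suc_shift) (simp add: sum.distrib ring_distribs add_ac)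
qed simp

lemma act_diffop_mult: "act p (D1 \<odot> D2) = act (act p D1) D2"
proof -
  have fp: "(pderiv ^^ l) ((pderiv ^^ i) p) = (pderiv ^^ (i + l)) p" for l i
    by (simp add: funpow_add add.commute[of i])
  have L: "(pderiv ^^ j) (f * g) = (\<Sum>l\<le>j. of_nat (j choose l) * ((pderiv ^^ l) f * (pderiv ^^ (j - l)) g))"
    for j and f g :: "complex poly" by (rule higher_pderiv_mult)
  have "act (act p D1) D2 = (\<Sum>j\<le>degree D2. \<Sum>i\<le>degree D1.
      (pderiv ^^ j) ((pderiv ^^ i) p * coeff D1 i) * coeff D2 j)"
    by (simp add: act_def higher_pderiv_sum sum_distrib_right)
  also have "\<dots> = (\<Sum>i\<le>degree D1. \<Sum>j\<le>degree D2.
      (pderiv ^^ j) ((pderiv ^^ i) p * coeff D1 i) * coeff D2 j)"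
    by (rule sum.swap)
  also have "\<dots> = (\<Sum>i\<le>degree D1. \<Sum>j\<le>degree D2. \<Sum>l\<le>j.
      (pderiv ^^ (i + l)) p * (of_nat (j choose l) * (pderiv ^^ (j - l)) (coeff D1 i) * coeff D2 j))"
    unfolding L fp sum_distrib_right by (intro sum.cong refl) (simp only: mult_ac)
  finally show ?thesis
    by (simp add: diffop_mult_def act_sum_right act_monom)
qed

text \<open>
  Degree preservation includes that nonzero polynomials are not mapped to \<open>0\<close>; this has to be
  said separately since \<open>degree 0 = 0\<close> in the library.
\<close>

definition degree_preserving :: "diffop \<Rightarrow> bool" where
  "degree_preserving D \<longleftrightarrow>
     (\<forall>p. degree (act p D) = degree p \<and> (p \<noteq> 0 \<longrightarrow> act p D \<noteq> 0))"


section \<open>Scalar weights and Darboux transformations\<close>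

text \<open>
  A weight on an interval is represented by a function on the whole line that is positive on the
  interval and vanishes outside.
\<close>

definition scalar_inner :: "(real \<Rightarrow> real) \<Rightarrow> complex poly \<Rightarrow> complex poly \<Rightarrow> complex" where
  "scalar_inner w p q =
     (LINT x|lborel. poly p (of_real x) * of_real (w x) * cnj (poly q (of_real x)))"

definition monic_orthogonal :: "(real \<Rightarrow> real) \<Rightarrow> (nat \<Rightarrow> complex poly) \<Rightarrow> bool" where
  "monic_orthogonal w p \<longleftrightarrow>
     (\<forall>n. degree (p n) = n \<and> lead_coeff (p n) = 1) \<and>
     (\<forall>m n. m \<noteq> n \<longrightarrow> scalar_inner w (p m) (p n) = 0)"

definition scalar_D :: "(real \<Rightarrow> real) \<Rightarrow> diffop set" where
  "scalar_D w = {D. \<exists>p. monic_orthogonal w p \<and> (\<forall>n. \<exists>c. act (p n) D = smult c (p n))}"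

text \<open>\<open>is_darboux_of w' w\<close>: the weight \<open>w'\<close> is a Darboux transformation of \<open>w\<close>.\<close>

definition is_darboux_of :: "(real \<Rightarrow> real) \<Rightarrow> (real \<Rightarrow> real) \<Rightarrow> bool" where
  "is_darboux_of w' w \<longleftrightarrow>
     {x. w' x \<noteq> 0} = {x. w x \<noteq> 0} \<and>
     (\<exists>p p' D V N. monic_orthogonal w p \<and> monic_orthogonal w' p' \<and>
        D \<in> scalar_D w \<and> D = V \<odot> N \<and> degree_preserving V \<and> degree_preserving N \<and>
        (\<exists>A. \<forall>n. act (p n) V = smult (A n) (p' n)))"


section \<open>The classical weights and the operators \<open>\<T>\<close>\<close>

datatype classical_weight =
  is_Hermite: Hermite real | is_Laguerre: Laguerre real | is_Jacobi: Jacobi real real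

fun admissible :: "classical_weight \<Rightarrow> bool" where
  "admissible (Hermite b) = True"
| "admissible (Laguerre \<alpha>) = (\<alpha> > -1)"
| "admissible (Jacobi \<alpha> \<beta>) = (\<alpha> > -1 \<and> \<beta> > -1)"

fun weight :: "classical_weight \<Rightarrow> real \<Rightarrow> real" where
  "weight (Hermite b) x = exp (- x\<^sup>2 + 2 * b * x)"
| "weight (Laguerre \<alpha>) x = (if 0 < x then exp (- x) * x powr \<alpha> else 0)"
| "weight (Jacobi \<alpha> \<beta>) x =
     (if -1 < x \<and> x < 1 then (1 - x) powr \<alpha> * (1 + x) powr \<beta> else 0)"

text \<open>\<open>(\<partial> - 1)^k\<close>\<close>

definition laguerre_up :: "nat \<Rightarrow> diffop" where
  "laguerre_up k = diffop_prod (replicate k [:-1, 1:])"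

text \<open>\<open>\<N>_k \<cdots> \<N>_1\<close> with \<open>\<N>_j = \<partial>x + \<alpha> + j\<close>\<close>

definition laguerre_down :: "real \<Rightarrow> nat \<Rightarrow> diffop" where
  "laguerre_down \<alpha> k =
     diffop_prod (map (\<lambda>j. [: [:of_real (\<alpha> + real j):], [:0, 1:] :]) (rev [1..<Suc k]))"

text \<open>\<open>\<V>_k \<cdots> \<V>_1\<close> with \<open>\<V>_j = \<partial>(1+x) + \<beta> + j\<close>\<close>

definition jacobi_up :: "real \<Rightarrow> nat \<Rightarrow> diffop" where
  "jacobi_up \<beta> k =
     diffop_prod (map (\<lambda>j. [: [:of_real (\<beta> + real j):], [:1, 1:] :]) (rev [1..<Suc k]))"

text \<open>\<open>\<M>_k \<cdots> \<M>_1\<close> with \<open>\<M>_j = \<partial>(x-1) + \<alpha> + j\<close>\<close>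

definition jacobi_down :: "real \<Rightarrow> nat \<Rightarrow> diffop" where
  "jacobi_down \<alpha> k =
     diffop_prod (map (\<lambda>j. [: [:of_real (\<alpha> + real j):], [:-1, 1:] :]) (rev [1..<Suc k]))"

text \<open>
  \<open>darboux_formula w w'\<close> is the explicit operator for two distinct weights of the same type that are
  Darboux transformations of each other. The value \<open>undefined\<close> belongs to parameters for which this
  never happens, so it does not enter \<open>\<T>\<close> below.
\<close>

fun darboux_formula :: "classical_weight \<Rightarrow> classical_weight \<Rightarrow> diffop" where
  "darboux_formula (Laguerre \<alpha>) (Laguerre \<alpha>') =
     (if \<alpha>' - \<alpha> \<in> \<nat> then laguerre_up (nat \<lfloor>\<alpha>' - \<alpha>\<rfloor>)
      else if \<alpha> - \<alpha>' \<in> \<nat> then laguerre_down \<alpha>' (nat \<lfloor>\<alpha> - \<alpha>'\<rfloor>)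
      else undefined)"
| "darboux_formula (Jacobi \<alpha> \<beta>) (Jacobi \<alpha>' \<beta>') =
     (if \<alpha> + \<beta> = \<alpha>' + \<beta>' \<and> \<alpha>' - \<alpha> \<in> \<nat> then jacobi_up \<beta>' (nat \<lfloor>\<alpha>' - \<alpha>\<rfloor>)
      else if \<alpha> + \<beta> = \<alpha>' + \<beta>' \<and> \<alpha> - \<alpha>' \<in> \<nat> then jacobi_down \<alpha>' (nat \<lfloor>\<alpha> - \<alpha>'\<rfloor>)
      else undefined)"
| "darboux_formula _ _ = undefined"

definition \<T> :: "classical_weight \<Rightarrow> classical_weight \<Rightarrow> diffop" where
  "\<T> w w' =
     (if \<not> is_darboux_of (weight w) (weight w') then 0
      else if w = w' then 1
      else darboux_formula w w')"


section \<open>Matrix differential operators and matrix weights\<close>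

text \<open>
  \<open>Mat_N(\<complex>)[x]\<close> is represented by matrices of polynomials, whose product is \<open>**\<close>, and an operator
  \<open>(\<Sum>j. \<partial>^j F_j(x))\<close> again by the polynomial in \<open>\<partial>\<close> with coefficients \<open>F_j\<close>.
\<close>

type_synonym 'n matpoly = "complex poly ^ 'n ^ 'n"
type_synonym 'n matdiffop = "(complex poly ^ 'n ^ 'n) poly"

definition mat_act :: "'n::finite matpoly \<Rightarrow> 'n matdiffop \<Rightarrow> 'n matpoly" where
  "mat_act P D = (\<Sum>j\<le>degree D. (map_matrix pderiv ^^ j) P ** coeff D j)"

definition mat_eval :: "'n::finite matpoly \<Rightarrow> real \<Rightarrow> complex ^ 'n ^ 'n" where
  "mat_eval P x = map_matrix (\<lambda>p. poly p (of_real x)) P"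

definition mat_coeff :: "'n::finite matpoly \<Rightarrow> nat \<Rightarrow> complex ^ 'n ^ 'n" where
  "mat_coeff P k = map_matrix (\<lambda>p. coeff p k) P"

definition mat_const :: "complex ^ 'n ^ 'n \<Rightarrow> 'n::finite matpoly" where
  "mat_const M = map_matrix (\<lambda>c. [:c:]) M"

definition adjoint_matrix :: "complex ^ 'n ^ 'n \<Rightarrow> complex ^ 'n ^ 'n::finite" where
  "adjoint_matrix M = map_matrix cnj (transpose M)"

definition mat_inner ::
  "(real \<Rightarrow> complex ^ 'n ^ 'n) \<Rightarrow> 'n::finite matpoly \<Rightarrow> 'n matpoly \<Rightarrow> complex ^ 'n ^ 'n" where
  "mat_inner W P Q =
     (LINT x|lborel. mat_eval P x ** W x ** adjoint_matrix (mat_eval Q x))"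

definition mat_monic :: "nat \<Rightarrow> 'n::finite matpoly \<Rightarrow> bool" where
  "mat_monic n P \<longleftrightarrow> mat_coeff P n = mat 1 \<and> (\<forall>k>n. mat_coeff P k = 0)"

definition mat_monic_orthogonal ::
  "(real \<Rightarrow> complex ^ 'n ^ 'n) \<Rightarrow> (nat \<Rightarrow> 'n::finite matpoly) \<Rightarrow> bool" where
  "mat_monic_orthogonal W P \<longleftrightarrow>
     (\<forall>n. mat_monic n (P n)) \<and> (\<forall>m n. m \<noteq> n \<longrightarrow> mat_inner W (P m) (P n) = 0)"

definition mat_D :: "(real \<Rightarrow> complex ^ 'n ^ 'n) \<Rightarrow> 'n::finite matdiffop set" where
  "mat_D W = {D. \<exists>P. mat_monic_orthogonal W P \<and>
     (\<forall>n. \<exists>\<Lambda>. mat_act (P n) D = mat_const \<Lambda> ** P n)}"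

definition direct_sum_weight ::
  "('n \<Rightarrow> real \<Rightarrow> real) \<Rightarrow> real \<Rightarrow> complex ^ 'n ^ 'n::finite" where
  "direct_sum_weight w x = (\<chi> i j. if i = j then of_real (w i x) else 0)"

text \<open>\<open>matrix_unit_op D i j\<close> is \<open>D E_{i,j}\<close>: every coefficient \<open>F\<close> of \<open>D\<close> becomes \<open>F E_{i,j}\<close>.\<close>

definition matrix_unit_op :: "diffop \<Rightarrow> 'n \<Rightarrow> 'n \<Rightarrow> 'n::finite matdiffop" where
  "matrix_unit_op D i j = map_poly (\<lambda>f. \<chi> a b. if a = i \<and> b = j then f else 0) D"

end

theory Submission
  imports Defs "HOL-Probability.Distributions" "HOL-Real_Asymp.Real_Asymp"
begin

text \<open>
  Write \<open>p_n\<close> and \<open>p'_n\<close> for the monic orthogonal polynomials of two classical weights \<open>w\<close> and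
  \<open>w'\<close> of the same type, and call an operator \<open>D\<close> an intertwiner from \<open>w\<close> to \<open>w'\<close> if \<open>p_n \<cdot> D\<close> is a multiple of
  \<open>p'_n\<close> for every \<open>n\<close>; the intertwiners from \<open>w\<close> to \<open>w\<close> form \<open>\<D>(w)\<close>. The monic orthogonal
  polynomials of a diagonal weight are the diagonal matrices of the scalar ones, so an operator with
  entries \<open>D_{i,j}\<close> lies in \<open>\<D>(w_1 \<oplus> \<cdots> \<oplus> w_N)\<close> exactly when each \<open>D_{i,j}\<close> is an intertwiner from
  \<open>w_i\<close> to \<open>w_j\<close> (\<open>mat_D_iff\<close>). What remains is a scalar statement: the intertwiners from \<open>w\<close> to
  \<open>w'\<close> are \<open>\<T>_{w,w'} \<cdot> \<D>(w')\<close> (\<open>intertwiners_eq\<close>).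

  Analysis enters only to replace orthogonality by algebra. Each classical weight satisfies a
  Pearson equation \<open>(q w)' = r w\<close> with polynomials \<open>q\<close>, \<open>r\<close>. It makes the operator
  \<open>\<delta>_w = \<partial>^2 q + \<partial> r\<close> symmetric, and as \<open>\<delta>_w\<close> is triangular on powers of \<open>x\<close> with distinct
  eigenvalues \<open>\<lambda>_n\<close>, the \<open>p_n\<close> are its monic eigenpolynomials (\<open>monic_orthogonal_iff\<close>).

  Suppose first that \<open>w\<close> and \<open>w'\<close> have the same eigenvalues. Then an intertwiner \<open>D\<close> satisfies
  \<open>\<delta>_w D = D \<delta>_{w'}\<close>. If \<open>D\<close> has order \<open>m\<close> and leading coefficient \<open>F\<close>, comparing the
  coefficients of \<open>\<partial>^(m+1)\<close> gives \<open>2 q F' = (m q' + r - r') F\<close>. This equation determines \<open>F\<close> up to a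
  constant factor, and the orders of vanishing of \<open>F\<close> at the zeros of \<open>q\<close> tie \<open>m\<close> to the parameters
  of the weights: a nonzero intertwiner between distinct weights exists only if the parameters
  differ by an integer of some absolute value \<open>k\<close>, and then \<open>m = k + 2 i\<close> for some \<open>i\<close>. For Hermite weights,
  where \<open>q = 1\<close>, the equation reads \<open>F' = (b - b') F\<close> and has no nonzero polynomial solution if
  \<open>b \<noteq> b'\<close>. Now \<open>\<T>_{w,w'}\<close> is an intertwiner of order \<open>k\<close>, so \<open>\<T>_{w,w'} \<delta>_{w'}^i\<close> is an
  intertwiner of the same order as \<open>D\<close> and some multiple of it cancels the leading term of \<open>D\<close>.
  Induction on the order yields \<open>D \<in> \<T>_{w,w'} \<cdot> \<D>(w')\<close> (\<open>intertwiners_principal\<close>).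

  The eigenvalues differ only for Jacobi weights with \<open>\<alpha> + \<beta> \<noteq> \<alpha>' + \<beta>'\<close>, and then every intertwiner
  vanishes (\<open>intertwiner_Jacobi_zero\<close>). Indeed, since \<open>q(1) = 0\<close>, the eigenvalue equation expresses
  all derivatives of \<open>p_n\<close> at \<open>1\<close> as \<open>p_n(1)\<close> times polynomials in \<open>\<lambda>_n\<close>. Evaluating
  \<open>p_n \<cdot> D\<close> and its derivative at \<open>1\<close>, and using that \<open>p_n \<cdot> D\<close> is a multiple of \<open>p'_n\<close>,
  one finds polynomials \<open>\<Phi>\<close>, \<open>\<Xi>\<close> with \<open>n \<Phi>(\<lambda>_n) = \<Xi>(\<lambda>_n)\<close>. As \<open>\<lambda>_n\<close> is
  quadratic in \<open>n\<close>, the two sides have degrees of different parity in \<open>n\<close>, so \<open>\<Phi> = 0\<close> and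
  \<open>p_n \<cdot> D = 0\<close> for all \<open>n\<close>.

  These facts also decide when \<open>\<T>_{w,w'}\<close> is defined to be zero: a Darboux factorization \<open>V N\<close>
  provides a nonzero intertwiner \<open>N\<close>, and conversely the explicit operators in the two directions
  compose to a Darboux factorization.
\<close>

section \<open>Operators and their action on polynomials\<close>

lemma smult_sum_right: "smult c (sum f A) = (\<Sum>a\<in>A. smult c (f a))"
  by (induction A rule: infinite_finite_induct) (simp_all add: smult_add_right)

lemma act_0_right [simp]: "act p 0 = 0"
  by (simp add: act_def)

lemma act_0_left [simp]: "act 0 D = 0"
  by (simp add: act_def)

lemma act_1_right [simp]: "act p 1 = p"
  by (simp add: act_def)

lemma act_smult_right: "act p (smult [:c:] D) = smult c (act p D)"
proof -
  have "act p (smult [:c:] D) = (\<Sum>j\<le>degree D. (pderiv ^^ j) p * coeff (smult [:c:] D) j)"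
    by (rule act_bound) (rule degree_smult_le)
  then show ?thesis
    by (simp add: act_def smult_sum_right)
qed

lemma act_diff_right: "act p (D1 - D2) = act p D1 - act p D2"
  using act_add_right[of p "D1 - D2" D2] by simp

lemma act_add_left: "act (p + p') D = act p D + act p' D"
  by (simp add: act_def higher_pderiv_add algebra_simps sum.distrib)

lemma act_smult_left: "act (smult c p) D = smult c (act p D)"
  by (simp add: act_def higher_pderiv_smult smult_sum_right)

lemma act_diff_left: "act (p - p') D = act p D - act p' D"
  using act_add_left[of "p - p'" p' D] by simp

lemma act_first_order: "act p [:f, g:] = p * f + pderiv p * g"
proof -
  have "act p [:f, g:] = (\<Sum>j\<le>1. (pderiv ^^ j) p * coeff [:f, g:] j)"
    by (rule act_bound) simp
  then show ?thesis by simp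
qed

lemma act_second_order: "act p [:0, r, q:] = pderiv p * r + pderiv (pderiv p) * q"
proof -
  have "act p [:0, r, q:] = (\<Sum>j\<le>2. (pderiv ^^ j) p * coeff [:0, r, q:] j)"
    by (rule act_bound) simp
  then show ?thesis by (simp add: numeral_2_eq_2)
qed

lemma higher_pderiv_monom_1:
  "(pderiv ^^ j) (monom (1::complex) m) =
     (if j \<le> m then monom (pochhammer (of_nat (Suc (m - j))) j) (m - j) else 0)"
  by (rule poly_eqI) (auto simp: coeff_higher_pderiv)

text \<open>
  The coefficients of an operator can be read off one after another from its values on the powers of
  \<open>x\<close>. This triangularity makes the action faithful and turns a bound on the degrees of all
  \<open>p \<cdot> D\<close> into bounds on the degrees of the coefficients.
\<close>

lemma act_monom_1:
  "act (monom 1 m) D = smult (fact m) (coeff D m)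
     + (\<Sum>j<m. monom (pochhammer (of_nat (Suc (m - j))) j) (m - j) * coeff D j)"
proof -
  have "act (monom 1 m) D = (\<Sum>j\<le>max m (degree D). (pderiv ^^ j) (monom 1 m) * coeff D j)"
    by (rule act_bound) simp
  also have "\<dots> = (\<Sum>j\<le>m. (pderiv ^^ j) (monom 1 m) * coeff D j)"
    by (rule sum.mono_neutral_right) (auto simp: higher_pderiv_monom_1)
  also have "\<dots> = (pderiv ^^ m) (monom 1 m) * coeff D m + (\<Sum>j<m. (pderiv ^^ j) (monom 1 m) * coeff D j)"
    by (simp add: lessThan_Suc_atMost [symmetric])
  also have "(pderiv ^^ m) (monom (1::complex) m) = monom (fact m) 0"
    by (simp add: higher_pderiv_monom_1 pochhammer_fact)
  also have "(\<Sum>j<m. (pderiv ^^ j) (monom 1 m) * coeff D j) =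
      (\<Sum>j<m. monom (pochhammer (of_nat (Suc (m - j))) j) (m - j) * coeff D j)"
    by (rule sum.cong) (simp_all add: higher_pderiv_monom_1)
  finally show ?thesis by (simp add: monom_0)
qed

lemma act_eq_0_imp:
  assumes "\<And>p. act p D = 0"
  shows "D = 0"
proof -
  have "coeff D m = 0" for m
  proof (induction m rule: less_induct)
    case (less m)
    then have "act (monom 1 m) D = smult (fact m) (coeff D m)"
      by (simp add: act_monom_1)
    then show ?case using assms[of "monom 1 m"] by simp
  qed
  then show ?thesis by (simp add: poly_eq_iff)
qed

lemma diffop_eqI: "(\<And>p. act p D1 = act p D2) \<Longrightarrow> D1 = D2"
  using act_eq_0_imp[of "D1 - D2"] by (simp add: act_diff_right)

lemma diffop_one_mult [simp]: "1 \<odot> D = D"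
  by (rule diffop_eqI) (simp add: act_diffop_mult)

lemma diffop_zero_mult [simp]: "0 \<odot> D = 0"
  by (rule diffop_eqI) (simp add: act_diffop_mult)

lemma diffop_mult_zero [simp]: "D \<odot> 0 = 0"
  by (rule diffop_eqI) (simp add: act_diffop_mult)

lemma diffop_mult_add_right: "A \<odot> (B + C) = A \<odot> B + A \<odot> C"
  by (rule diffop_eqI) (simp add: act_diffop_mult act_add_right)

lemma diffop_mult_smult_right: "A \<odot> smult [:c:] B = smult [:c:] (A \<odot> B)"
  by (rule diffop_eqI) (simp add: act_diffop_mult act_smult_right)

text \<open>
  The commutator corrections of the Leibniz rule have lower order, so leading coefficients multiply
  and, over the integral domain of polynomials, orders add.
\<close>

lemma coeff_diffop_mult_top: "coeff (D1 \<odot> D2) (degree D1 + degree D2) = lead_coeff D1 * lead_coeff D2"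
  and degree_diffop_mult_le: "degree (D1 \<odot> D2) \<le> degree D1 + degree D2"
proof -
  let ?m = "degree D1" and ?n = "degree D2"
  let ?f = "\<lambda>i j l. of_nat (j choose l) * (pderiv ^^ (j - l)) (coeff D1 i) * coeff D2 j"
  have if_c: "(\<Sum>l\<in>A. if c then g l else 0) = (if c then sum g A else 0)"
    for c and A :: "nat set" and g :: "nat \<Rightarrow> complex poly" by simp
  have "coeff (D1 \<odot> D2) (?m + ?n) =
      (\<Sum>i\<le>?m. \<Sum>j\<le>?n. \<Sum>l\<le>j. if i + l = ?m + ?n then ?f i j l else 0)"
    by (simp add: diffop_mult_def coeff_sum coeff_monom)
  also have "\<dots> = (\<Sum>i\<le>?m. \<Sum>j\<le>?n. \<Sum>l\<le>j.
      if i = ?m then if j = ?n then if l = ?n then ?f i j l else 0 else 0 else 0)"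
    by (intro sum.cong refl) auto
  also have "\<dots> = ?f ?m ?n ?n"
    by (simp only: if_c) (simp add: sum.delta)
  finally show "coeff (D1 \<odot> D2) (?m + ?n) = lead_coeff D1 * lead_coeff D2" by simp
  show "degree (D1 \<odot> D2) \<le> ?m + ?n"
    unfolding diffop_mult_def
    by (intro degree_sum_le finite_atMost) (auto intro!: order.trans[OF degree_monom_le])
qed

lemma degree_diffop_mult:
  assumes "D1 \<noteq> 0" "D2 \<noteq> 0"
  shows "degree (D1 \<odot> D2) = degree D1 + degree D2"
proof -
  have "coeff (D1 \<odot> D2) (degree D1 + degree D2) \<noteq> 0"
    using assms by (simp add: coeff_diffop_mult_top)
  then show ?thesis
    using degree_diffop_mult_le[of D1 D2] le_degree by (metis le_antisym)
qed

lemma degree_coeff_le_if_degree_nonincreasing: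
  assumes "\<And>p. degree (act p D) \<le> degree p"
  shows "degree (coeff D m) \<le> m"
proof (induction m rule: less_induct)
  case (less m)
  let ?c = "\<lambda>j. monom (pochhammer (of_nat (Suc (m - j))) j) (m - j) :: complex poly"
  let ?S = "\<Sum>j<m. ?c j * coeff D j"
  have S: "degree ?S \<le> m"
  proof (intro degree_sum_le)
    fix j assume j: "j \<in> {..<m}"
    have "degree (?c j * coeff D j) \<le> degree (?c j) + degree (coeff D j)"
      by (rule degree_mult_le)
    also have "\<dots> \<le> (m - j) + j"
      using less[of j] j by (intro add_mono degree_monom_le) auto
    finally show "degree (?c j * coeff D j) \<le> m" using j by simp
  qed simp
  have "degree (act (monom 1 m) D) \<le> m"
    using assms[of "monom 1 m"] by (rule order.trans) (rule degree_monom_le)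
  then have "degree (act (monom 1 m) D - ?S) \<le> m"
    using S by (rule degree_diff_le)
  moreover have "act (monom 1 m) D - ?S = smult (fact m) (coeff D m)"
    unfolding act_monom_1 by (rule add_diff_cancel)
  ultimately show ?case by simp
qed

text \<open>
  A sequence with exactly one polynomial in each degree is a basis; this is the induction principle
  for statements that are known on the basis and pass to linear combinations.
\<close>

lemma poly_basis_induct [case_names degree nonzero zero step]:
  fixes P :: "nat \<Rightarrow> complex poly"
  assumes deg: "\<And>n. degree (P n) = n" and nz: "\<And>n. P n \<noteq> 0"
    and zero: "Q 0"
    and step: "\<And>n c p. p = 0 \<or> degree p < n \<Longrightarrow> c \<noteq> 0 \<Longrightarrow> Q p \<Longrightarrow> Q (p + smult c (P n))"
  shows "Q p"
proof (induction "if p = 0 then 0 else Suc (degree p)" arbitrary: p rule: less_induct)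
  case less
  show ?case
  proof (cases "p = 0")
    case True
    then show ?thesis by (simp add: zero)
  next
    case False
    define n where "n = degree p"
    define c where "c = lead_coeff p / lead_coeff (P n)"
    define p' where "p' = p - smult c (P n)"
    have P: "coeff (P n) n \<noteq> 0"
      using nz[of n] deg[of n] by (metis leading_coeff_0_iff)
    then have "coeff p' n = 0"
      by (simp add: p'_def c_def n_def deg)
    moreover have "degree p' \<le> n"
      unfolding p'_def by (intro degree_diff_le) (auto simp: n_def deg)
    ultimately have p': "p' = 0 \<or> degree p' < n"
      by (metis le_neq_implies_less leading_coeff_0_iff)
    then have "Q p'" using False by (intro less) (auto simp: n_def)
    moreover have "c \<noteq> 0" using False P by (simp add: c_def n_def deg)
    ultimately show ?thesis using step[of p' n c] p' by (simp add: p'_def)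
  qed
qed

section \<open>Intertwining of second-order operators\<close>

text \<open>
  Leibniz rule for \<open>\<delta> = \<partial>^2 q + \<partial> r\<close> followed by \<open>\<partial>^j\<close>; it stops after three terms because
  \<open>q\<close> and \<open>r\<close> have degrees at most \<open>2\<close> and \<open>1\<close>. It is used for all \<open>x\<close> to compare
  coefficients of operators, and at the zero \<open>x = 1\<close> of the Jacobi \<open>q\<close> as a recursion for
  derivatives.
\<close>

lemma higher_pderiv_act_second_order:
  fixes p q r :: "complex poly"
  assumes q: "pderiv (pderiv (pderiv q)) = 0" and r: "pderiv (pderiv r) = 0"
  shows "(pderiv ^^ j) (act p [:0, r, q:]) = (pderiv ^^ (j + 2)) p * q
    + (pderiv ^^ (j + 1)) p * (of_nat j * pderiv q + r)
    + (pderiv ^^ j) p * (of_nat (j choose 2) * pderiv (pderiv q) + of_nat j * pderiv r)"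
proof (induction j)
  case (Suc j)
  have c: "pderiv (of_nat m * s) = of_nat m * pderiv s" for m and s :: "complex poly"
    by (simp add: of_nat_poly pderiv_smult)
  have ch: "of_nat (Suc j choose 2) = (of_nat (j choose 2) + of_nat j :: complex poly)"
    by (simp add: numeral_2_eq_2)
  define P0 P1 P2 P3 where "P0 = (pderiv ^^ j) p" and "P1 = pderiv P0" and "P2 = pderiv P1" and "P3 = pderiv P2"
  have "(pderiv ^^ Suc j) (act p [:0, r, q:]) = pderiv (P2 * q + P1 * (of_nat j * pderiv q + r)
      + P0 * (of_nat (j choose 2) * pderiv (pderiv q) + of_nat j * pderiv r))"
    using Suc by (simp add: P0_def P1_def P2_def)
  also have "\<dots> = P3 * q + P2 * ((of_nat j + 1) * pderiv q + r)
      + P1 * ((of_nat (j choose 2) + of_nat j) * pderiv (pderiv q) + (of_nat j + 1) * pderiv r)"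
    unfolding pderiv_add pderiv_mult c q r P1_def [symmetric] P2_def [symmetric] P3_def [symmetric]
    by (simp add: algebra_simps)
  finally show ?case
    unfolding ch by (simp add: P0_def P1_def P2_def P3_def add.commute)
qed (simp add: act_second_order)

text \<open>
  In \<open>\<delta> D = D \<delta>'\<close> the terms with \<open>\<partial>^(m+2)\<close> cancel because \<open>\<delta>\<close> and \<open>\<delta>'\<close> have the same
  leading coefficient \<open>q\<close>. In the coefficient of \<open>\<partial>^(m+1)\<close> the contributions of the second
  coefficient of \<open>D\<close> cancel for the same reason, and what remains is a first-order equation for the leading
  coefficient alone.
\<close>

lemma intertwining_leading_coeff:
  fixes D :: diffop and q r r' :: "complex poly"
  assumes q: "pderiv (pderiv (pderiv q)) = 0" and r: "pderiv (pderiv r) = 0"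
    and comm: "\<And>p. act (act p [:0, r, q:]) D = act (act p D) [:0, r', q:]"
  defines "m \<equiv> degree D" and "F \<equiv> lead_coeff D"
  shows "2 * q * pderiv F = (of_nat m * pderiv q + r - r') * F"
proof -
  let ?F = "coeff D"
  define u where "u = (\<lambda>j. ?F j * (of_nat j * pderiv q + r) - 2 * q * pderiv (?F j) - r' * ?F j)"
  define v where "v = (\<lambda>j. ?F j * (of_nat (j choose 2) * pderiv (pderiv q) + of_nat j * pderiv r)
     - q * pderiv (pderiv (?F j)) - r' * pderiv (?F j))"
  \<comment> \<open>\<open>E\<close> is \<open>\<delta> D - D \<delta>'\<close>, with the cancelling terms of order \<open>j + 2\<close> left out.\<close>
  define E where "E = (\<Sum>j\<le>m. monom (u j) (Suc j) + monom (v j) j)"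
  have "act p E = 0" for p
  proof -
    have "act (act p D) [:0, r', q:] = (\<Sum>j\<le>m.
        pderiv ((pderiv ^^ j) p * ?F j) * r' + pderiv (pderiv ((pderiv ^^ j) p * ?F j)) * q)"
      unfolding act_second_order
      by (simp add: act_def m_def Defs.pderiv_sum sum_distrib_right sum.distrib)
    moreover have "act (act p [:0, r, q:]) D = (\<Sum>j\<le>m. ((pderiv ^^ (j + 2)) p * q
        + (pderiv ^^ (j + 1)) p * (of_nat j * pderiv q + r)
        + (pderiv ^^ j) p * (of_nat (j choose 2) * pderiv (pderiv q) + of_nat j * pderiv r)) * ?F j)"
      unfolding act_def[of _ D] higher_pderiv_act_second_order[OF q r] m_def ..
    ultimately have "0 = (\<Sum>j\<le>m. ((pderiv ^^ (j + 2)) p * q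
        + (pderiv ^^ (j + 1)) p * (of_nat j * pderiv q + r)
        + (pderiv ^^ j) p * (of_nat (j choose 2) * pderiv (pderiv q) + of_nat j * pderiv r)) * ?F j
        - (pderiv ((pderiv ^^ j) p * ?F j) * r' + pderiv (pderiv ((pderiv ^^ j) p * ?F j)) * q))"
      using comm[of p] by (simp add: sum_subtractf)
    also have "\<dots> = (\<Sum>j\<le>m. (pderiv ^^ Suc j) p * u j + (pderiv ^^ j) p * v j)"
      unfolding u_def v_def
      by (intro sum.cong refl) (simp add: pderiv_mult pderiv_add algebra_simps)
    also have "\<dots> = act p E"
      unfolding E_def by (simp only: act_sum_right act_add_right act_monom)
    finally show ?thesis by simp
  qed
  then have "E = 0" by (rule act_eq_0_imp)
  then have "0 = coeff E (Suc m)" by simp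
  also have "\<dots> = (\<Sum>j\<le>m. (if j = m then u j else 0))"
    unfolding E_def coeff_sum by (intro sum.cong) auto
  also have "\<dots> = u m" by (simp add: sum.delta)
  finally show ?thesis
    unfolding u_def F_def m_def by (simp add: algebra_simps)
qed

section \<open>Polynomial solutions of first-order linear equations\<close>

text \<open>
  The equation says \<open>F'/F = v / ((x - a) u)\<close>. The left side has residue equal to the order of \<open>F\<close> at
  \<open>a\<close>, the right side has residue \<open>v(a) / u(a)\<close> if \<open>u(a) \<noteq> 0\<close>.
\<close>

lemma order_times_residue:
  fixes F u v :: "complex poly"
  assumes ode: "[:-a, 1:] * u * pderiv F = v * F" and "F \<noteq> 0"
  shows "of_nat (order a F) * poly u a = poly v a"
proof -
  define k where "k = order a F"
  obtain G where G: "F = [:-a, 1:] ^ k * G" "\<not> [:-a, 1:] dvd G"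
    using order_decomp[OF \<open>F \<noteq> 0\<close>] unfolding k_def by blast
  define y where "y = [:-a, 1:]"
  have "pderiv y = 1" by (simp add: y_def pderiv_pCons)
  then have y: "y * pderiv (y ^ k) = of_nat k * y ^ k"
  proof (cases k)
    case (Suc l)
    then show ?thesis
      unfolding Suc pderiv_power_Suc \<open>pderiv y = 1\<close>
      by (simp add: of_nat_poly del: of_nat_Suc)
  qed simp
  note G = G[folded y_def] and ode = ode[folded y_def]
  have "y ^ k * (of_nat k * u * G + y * u * pderiv G) = (y * pderiv (y ^ k)) * u * G + y ^ k * (y * u * pderiv G)"
    unfolding y by (simp add: algebra_simps)
  also have "\<dots> = y * u * pderiv F"
    by (simp add: G(1) pderiv_mult algebra_simps)
  also have "\<dots> = y ^ k * (v * G)"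
    unfolding ode by (simp add: G(1))
  finally have "of_nat k * u * G + y * u * pderiv G = v * G"
    using \<open>pderiv y = 1\<close> by auto
  then have "poly (of_nat k * u * G + y * u * pderiv G) a = poly (v * G) a" by simp
  then have "of_nat k * poly u a * poly G a = poly v a * poly G a"
    by (simp add: y_def of_nat_poly)
  moreover have "poly G a \<noteq> 0" using G(2) by (simp add: poly_eq_0_iff_dvd y_def)
  ultimately show ?thesis by (simp add: k_def)
qed

text \<open>
  Subtracting a multiple of \<open>H\<close> produces a solution \<open>G\<close> that vanishes at a point where \<open>H\<close> does not.
  The Wronskian relation \<open>G' H = G H'\<close> then fails at this point, since differentiation lowers the
  order of a zero by one, unless \<open>G = 0\<close>.
\<close>

lemma proportional_if_same_log_derivative:
  fixes F H q v :: "complex poly"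
  assumes F: "q * pderiv F = v * F" and H: "q * pderiv H = v * H" and "H \<noteq> 0" "q \<noteq> 0"
  shows "\<exists>c. F = smult c H"
proof -
  obtain a where a: "poly H a \<noteq> 0"
    using \<open>H \<noteq> 0\<close> poly_all_0_iff_0 by blast
  define c where "c = poly F a / poly H a"
  define G where "G = F - smult c H"
  have G: "q * pderiv G = v * G"
    using F H by (simp add: G_def pderiv_diff pderiv_smult right_diff_distrib)
  have "q * (pderiv G * H) = q * (G * pderiv H)"
    using G H by (metis (no_types, opaque_lifting) mult.assoc mult.commute)
  then have W: "pderiv G * H = G * pderiv H" using \<open>q \<noteq> 0\<close> by simp
  have root: "poly G a = 0" using a by (simp add: G_def c_def)
  have "G = 0"
  proof (rule ccontr)
    assume nz: "G \<noteq> 0"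
    have "pderiv G \<noteq> 0"
    proof
      assume "pderiv G = 0"
      then have "degree G = 0" by (simp add: pderiv_eq_0_iff)
      then obtain c' where "G = [:c':]" by (rule degree_eq_zeroE)
      then show False using nz root by simp
    qed
    have o': "order a G = Suc (order a (pderiv G))"
      using nz root by (rule order_pderiv)
    have WH: "pderiv G * H \<noteq> 0" using \<open>pderiv G \<noteq> 0\<close> \<open>H \<noteq> 0\<close> by simp
    have "order a (pderiv G * H) = order a (pderiv G)"
      using WH a by (simp add: order_mult order_0I)
    moreover have "order a (G * pderiv H) \<ge> order a G"
      using WH W by (simp add: order_mult)
    ultimately show False using W o' by simp
  qed
  then show ?thesis by (auto simp: G_def)
qed

section \<open>Pearson equations of the classical weights\<close>

text \<open>
  Coefficients of the Pearson equation \<open>(q w)' = r w\<close>, which holds on the interval of the weight.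
\<close>

fun pearson_q :: "classical_weight \<Rightarrow> complex poly" where
  "pearson_q (Hermite b) = 1"
| "pearson_q (Laguerre \<alpha>) = [:0, 1:]"
| "pearson_q (Jacobi \<alpha> \<beta>) = [:1, 0, -1:]"

fun pearson_r :: "classical_weight \<Rightarrow> complex poly" where
  "pearson_r (Hermite b) = [:of_real (2 * b), -2:]"
| "pearson_r (Laguerre \<alpha>) = [:of_real (\<alpha> + 1), -1:]"
| "pearson_r (Jacobi \<alpha> \<beta>) = [:of_real (\<beta> - \<alpha>), - of_real (\<alpha> + \<beta> + 2):]"

lemma integrable_poly_times:
  fixes w :: "real \<Rightarrow> real"
  assumes "\<And>k. integrable M (\<lambda>x. g x ^ k * w x)"
  shows "integrable M (\<lambda>x. poly p (complex_of_real (g x)) * of_real (w x))"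
proof -
  have "poly p (complex_of_real (g x)) * of_real (w x) = (\<Sum>k\<le>degree p. coeff p k * of_real (g x ^ k * w x))" for x
    by (simp add: poly_altdef sum_distrib_right mult.assoc)
  then show ?thesis
    using assms by (simp del: of_real_mult of_real_power)
qed

lemma tendsto_poly_times_0:
  fixes w :: "real \<Rightarrow> real"
  assumes "\<And>k. ((\<lambda>x. x ^ k * w x) \<longlongrightarrow> 0) F"
  shows "((\<lambda>x. poly p (complex_of_real x) * of_real (w x)) \<longlongrightarrow> 0) F"
proof -
  have eq: "poly p (complex_of_real x) * of_real (w x) = (\<Sum>k\<le>degree p. coeff p k * of_real (x ^ k * w x))" for x
    by (simp add: poly_altdef sum_distrib_right mult.assoc)
  have "((\<lambda>x. \<Sum>k\<le>degree p. coeff p k * of_real (x ^ k * w x)) \<longlongrightarrow> (\<Sum>k\<le>degree p. coeff p k * of_real 0)) F"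
    by (intro tendsto_sum tendsto_mult_left tendsto_of_real assms)
  then show ?thesis unfolding eq by simp
qed

lemma tendsto_poly_times_0_at:
  fixes w :: "real \<Rightarrow> real"
  assumes "((\<lambda>x. poly q (complex_of_real x) * of_real (w x)) \<longlongrightarrow> 0) (at c within S)"
  shows "((\<lambda>x. poly (q * u) (complex_of_real x) * of_real (w x)) \<longlongrightarrow> 0) (at c within S)"
proof -
  have "((\<lambda>x. poly u (complex_of_real x) * (poly q (complex_of_real x) * of_real (w x)))
      \<longlongrightarrow> poly u (of_real c) * 0) (at c within S)"
    by (intro tendsto_mult assms tendsto_intros)
  then show ?thesis by (simp add: mult_ac)
qed

text \<open>
  The integrand is the derivative of \<open>q u w\<close>, which vanishes at both ends of the interval.
\<close>

lemma integral_pearson: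
  fixes w w' :: "real \<Rightarrow> real" and a b :: ereal
  assumes "a < b"
    and zero: "\<And>x. \<not> (a < ereal x \<and> ereal x < b) \<Longrightarrow> w x = 0"
    and deriv: "\<And>x. a < ereal x \<Longrightarrow> ereal x < b \<Longrightarrow> (w has_real_derivative w' x) (at x)"
    and pearson: "\<And>x. a < ereal x \<Longrightarrow> ereal x < b \<Longrightarrow>
      poly q (of_real x) * of_real (w' x) = (poly r (of_real x) - poly (pderiv q) (of_real x)) * complex_of_real (w x)"
    and int: "\<And>p. integrable lborel (\<lambda>x. poly p (complex_of_real x) * of_real (w x))"
    and A: "(((\<lambda>x. poly (q * u) (complex_of_real x) * of_real (w x)) \<circ> real_of_ereal) \<longlongrightarrow> 0) (at_right a)"
    and B: "(((\<lambda>x. poly (q * u) (complex_of_real x) * of_real (w x)) \<circ> real_of_ereal) \<longlongrightarrow> 0) (at_left b)"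
  shows "(LINT x|lborel. poly (q * pderiv u + r * u) (complex_of_real x) * of_real (w x)) = 0"
proof -
  let ?f = "\<lambda>x. poly (q * pderiv u + r * u) (complex_of_real x) * of_real (w x)"
  have eq: "indicator (einterval a b) x *\<^sub>R ?f x = ?f x" for x
    using zero[of x] by (cases "x \<in> einterval a b") (auto simp: einterval_def)
  have "(LBINT x=a..b. ?f x) = 0 - 0"
  proof (rule interval_integral_FTC_integrable[OF \<open>a < b\<close> _ _ _ A B])
    fix x assume x: "a < ereal x" "ereal x < b"
    have "((\<lambda>x. poly (q * u) (complex_of_real x) * of_real (w x)) has_vector_derivative
        (poly (q * u) (of_real x) * of_real (w' x) + poly (pderiv (q * u)) (of_real x) * of_real (w x))) (at x)"
      by (intro has_vector_derivative_mult has_vector_derivative_of_real deriv x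
          has_vector_derivative_real_field poly_DERIV)
    also have "poly (q * u) (of_real x) * of_real (w' x) = poly u (of_real x) * (poly q (of_real x) * of_real (w' x))"
      by simp
    also have "\<dots> + poly (pderiv (q * u)) (of_real x) * of_real (w x) = ?f x"
      unfolding pearson[OF x] by (simp add: pderiv_mult algebra_simps)
    finally show "((\<lambda>x. poly (q * u) (complex_of_real x) * of_real (w x)) has_vector_derivative ?f x) (at x)" .
    have "isCont w x" using deriv[OF x] by (rule DERIV_isCont)
    then show "isCont ?f x" by (intro continuous_intros)
  next
    show "set_integrable lborel (einterval a b) ?f"
      unfolding set_integrable_def eq by (rule int)
  qed
  moreover have "(LBINT x=a..b. ?f x) = (LINT x|lborel. ?f x)"
    using \<open>a < b\<close> by (simp only: interval_lebesgue_integral_def set_lebesgue_integral_def eq less_imp_le if_True)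
  ultimately show ?thesis by simp
qed

lemma integrable_poly_Hermite:
  "integrable lborel (\<lambda>x. poly p (complex_of_real x) * of_real (weight (Hermite b) x))"
proof -
  \<comment> \<open>Completing the square gives a normal density with mean \<open>b\<close> and variance \<open>1/2\<close>,
    so moments are taken around \<open>b\<close>.\<close>
  have w: "weight (Hermite b) x = sqrt pi * exp (b\<^sup>2) * normal_density b (1 / sqrt 2) x" for x
    by (simp add: normal_density_def power_divide real_sqrt_mult exp_add [symmetric] power2_eq_square algebra_simps)
  have "integrable lborel (\<lambda>x. (x - b) ^ k * weight (Hermite b) x)" for k
  proof -
    have "integrable lborel (\<lambda>x. sqrt pi * exp (b\<^sup>2) * (normal_density b (1 / sqrt 2) x * (x - b) ^ k))"
      by (intro integrable_mult_right integrable_normal_moment) simp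
    then show ?thesis unfolding w by (simp add: mult_ac)
  qed
  then have "integrable lborel (\<lambda>x. poly (pcompose p [:of_real b, 1:]) (complex_of_real (x - b)) * of_real (weight (Hermite b) x))"
    by (rule integrable_poly_times)
  then show ?thesis by (simp add: poly_pcompose)
qed

lemma integrable_poly_Laguerre:
  assumes "\<alpha> > -1"
  shows "integrable lborel (\<lambda>x. poly p (complex_of_real x) * of_real (weight (Laguerre \<alpha>) x))"
proof (rule integrable_poly_times)
  fix k :: nat
  let ?s = "\<alpha> + k + 1"
  have s: "?s > 0" using assms by simp
  have "integrable lborel (\<lambda>t. indicator {0..} t * t powr (?s - 1) / exp t)"
  proof (rule integrableI_nonneg)
    show "(\<integral>\<^sup>+ t. ennreal (indicator {0..} t * t powr (?s - 1) / exp t) \<partial>lborel) < \<infinity>"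
      unfolding Gamma_conv_nn_integral_real[OF s, symmetric] by simp
  qed auto
  also have "(\<lambda>t::real. indicator {0..} t * t powr (?s - 1) / exp t) = (\<lambda>x. x ^ k * weight (Laguerre \<alpha>) x)"
    by (rule ext) (auto simp: indicator_def powr_add powr_realpow exp_minus field_simps)
  finally show "integrable lborel (\<lambda>x. x ^ k * weight (Laguerre \<alpha>) x)" .
qed

lemma integrable_poly_Jacobi:
  assumes "\<alpha> > -1" "\<beta> > -1"
  shows "integrable lborel (\<lambda>x. poly p (complex_of_real x) * of_real (weight (Jacobi \<alpha> \<beta>) x))"
proof (rule integrable_poly_times)
  fix k :: nat
  have [measurable]: "weight (Jacobi \<alpha> \<beta>) \<in> borel_measurable borel"
    unfolding weight.simps by measurable
  \<comment> \<open>The substitution \<open>t = (1 + x) / 2\<close> turns the weight into the integrand of the Beta function.\<close>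
  have "integrable lborel (\<lambda>t. indicator {0..1} t *\<^sub>R (t powr (\<beta> + 1 - 1) * (1 - t) powr (\<alpha> + 1 - 1)))"
    using integrable_Beta[of "\<beta> + 1" "\<alpha> + 1"] assms unfolding set_integrable_def by simp
  then have "integrable lborel (\<lambda>x. indicator {0..1} (1/2 + 1/2 * x) *\<^sub>R
      ((1/2 + 1/2 * x) powr (\<beta> + 1 - 1) * (1 - (1/2 + 1/2 * x)) powr (\<alpha> + 1 - 1)))"
    by (rule lborel_integrable_real_affine) simp
  then have "integrable lborel (\<lambda>x. 2 powr (\<alpha> + \<beta>) * (indicator {0..1} (1/2 + 1/2 * x) *\<^sub>R
      ((1/2 + 1/2 * x) powr (\<beta> + 1 - 1) * (1 - (1/2 + 1/2 * x)) powr (\<alpha> + 1 - 1))))"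
    by (rule integrable_mult_right)
  then show "integrable lborel (\<lambda>x. x ^ k * weight (Jacobi \<alpha> \<beta>) x)"
  proof (rule Bochner_Integration.integrable_bound)
    show "AE x in lborel. norm (x ^ k * weight (Jacobi \<alpha> \<beta>) x) \<le> norm (2 powr (\<alpha> + \<beta>) * (indicator {0..1} (1/2 + 1/2 * x) *\<^sub>R
      ((1/2 + 1/2 * x) powr (\<beta> + 1 - 1) * (1 - (1/2 + 1/2 * x)) powr (\<alpha> + 1 - 1))))"
    proof (rule AE_I2)
      fix x :: real
      show "norm (x ^ k * weight (Jacobi \<alpha> \<beta>) x) \<le> norm (2 powr (\<alpha> + \<beta>) * (indicator {0..1} (1/2 + 1/2 * x) *\<^sub>R
        ((1/2 + 1/2 * x) powr (\<beta> + 1 - 1) * (1 - (1/2 + 1/2 * x)) powr (\<alpha> + 1 - 1))))"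
      proof (cases "-1 < x \<and> x < 1")
        case True
        have "(1 + x) powr \<beta> = 2 powr \<beta> * (1/2 + 1/2 * x) powr \<beta>"
          using True by (subst powr_mult [symmetric]) (auto simp: algebra_simps)
        moreover have "(1 - x) powr \<alpha> = 2 powr \<alpha> * (1 - (1/2 + 1/2 * x)) powr \<alpha>"
          using True by (subst powr_mult [symmetric]) (auto simp: algebra_simps)
        ultimately have "norm (2 powr (\<alpha> + \<beta>) * (indicator {0..1} (1/2 + 1/2 * x) *\<^sub>R
            ((1/2 + 1/2 * x) powr (\<beta> + 1 - 1) * (1 - (1/2 + 1/2 * x)) powr (\<alpha> + 1 - 1)))) = weight (Jacobi \<alpha> \<beta>) x"
          using True by (simp add: powr_add abs_mult)
        moreover have "norm (x ^ k * weight (Jacobi \<alpha> \<beta>) x) \<le> 1 * weight (Jacobi \<alpha> \<beta>) x"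
          unfolding norm_mult using True
          by (intro mult_mono) (auto simp: power_abs intro!: power_le_one)
        ultimately show ?thesis by simp
      next
        case False
        then have "weight (Jacobi \<alpha> \<beta>) x = 0" by (simp only: weight.simps if_False)
        then show ?thesis by (simp only: mult_zero_right norm_zero norm_ge_zero)
      qed
    qed
  qed measurable
qed

lemma integrable_poly_weight:
  "admissible w \<Longrightarrow> integrable lborel (\<lambda>x. poly p (complex_of_real x) * of_real (weight w x))"
  by (cases w) (simp_all only: admissible.simps integrable_poly_Hermite integrable_poly_Laguerre integrable_poly_Jacobi)

lemma pearson_Hermite:
  "(LINT x|lborel. poly (pearson_q (Hermite b) * pderiv u + pearson_r (Hermite b) * u) (complex_of_real x)
     * of_real (weight (Hermite b) x)) = 0"
proof (rule integral_pearson[where a = "-\<infinity>" and b = \<infinity> and w' = "\<lambda>x. (2 * b - 2 * x) * exp (- x\<^sup>2 + 2 * b * x)"])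
  show "(weight (Hermite b) has_real_derivative (2 * b - 2 * x) * exp (- x\<^sup>2 + 2 * b * x)) (at x)" for x
    unfolding weight.simps by (auto intro!: derivative_eq_intros)
  have "((\<lambda>x::real. x ^ k * exp (- x\<^sup>2 + 2 * b * x)) \<longlongrightarrow> 0) at_top" for k by real_asymp
  then show "(((\<lambda>x. poly (pearson_q (Hermite b) * u) (complex_of_real x) * of_real (weight (Hermite b) x)) \<circ> real_of_ereal) \<longlongrightarrow> 0) (at_left \<infinity>)"
    unfolding ereal_tendsto_simps by (intro tendsto_poly_times_0) simp
  have "((\<lambda>x::real. x ^ k * exp (- x\<^sup>2 + 2 * b * x)) \<longlongrightarrow> 0) at_bot" for k by real_asymp
  then show "(((\<lambda>x. poly (pearson_q (Hermite b) * u) (complex_of_real x) * of_real (weight (Hermite b) x)) \<circ> real_of_ereal) \<longlongrightarrow> 0) (at_right (-\<infinity>))"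
    unfolding ereal_tendsto_simps by (intro tendsto_poly_times_0) simp
  show "integrable lborel (\<lambda>x. poly p (complex_of_real x) * of_real (weight (Hermite b) x))" for p
    by (rule integrable_poly_Hermite)
qed (simp_all add: algebra_simps)

lemma pearson_Laguerre:
  assumes \<alpha>: "\<alpha> > -1"
  shows "(LINT x|lborel. poly (pearson_q (Laguerre \<alpha>) * pderiv u + pearson_r (Laguerre \<alpha>) * u) (complex_of_real x)
     * of_real (weight (Laguerre \<alpha>) x)) = 0"
proof (rule integral_pearson[where a = 0 and b = \<infinity> and w' = "\<lambda>x. (\<alpha> / x - 1) * (exp (- x) * x powr \<alpha>)"])
  fix x assume "0 < ereal x"
  then have x: "x > 0" by simp
  have "((\<lambda>x. exp (- x) * x powr \<alpha>) has_real_derivative (\<alpha> / x - 1) * (exp (- x) * x powr \<alpha>)) (at x)"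
    using x by (auto intro!: derivative_eq_intros simp: powr_diff field_simps)
  then show "(weight (Laguerre \<alpha>) has_real_derivative (\<alpha> / x - 1) * (exp (- x) * x powr \<alpha>)) (at x)"
    by (rule has_field_derivative_transform_within_open[where S = "{0<..}"]) (use x in auto)
  show "poly (pearson_q (Laguerre \<alpha>)) (of_real x) * of_real ((\<alpha> / x - 1) * (exp (- x) * x powr \<alpha>)) =
      (poly (pearson_r (Laguerre \<alpha>)) (of_real x) - poly (pderiv (pearson_q (Laguerre \<alpha>))) (of_real x)) * complex_of_real (weight (Laguerre \<alpha>) x)"
    using x by (simp add: pderiv_pCons field_simps)
next
  have "((\<lambda>x::real. x ^ k * (exp (- x) * x powr \<alpha>)) \<longlongrightarrow> 0) at_top" for k by real_asymp
  then have "((\<lambda>x::real. x ^ k * weight (Laguerre \<alpha>) x) \<longlongrightarrow> 0) at_top" for k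
    by (rule Lim_transform_eventually) (auto intro: eventually_mono[OF eventually_gt_at_top[of 0]])
  then show "(((\<lambda>x. poly (pearson_q (Laguerre \<alpha>) * u) (complex_of_real x) * of_real (weight (Laguerre \<alpha>) x)) \<circ> real_of_ereal) \<longlongrightarrow> 0) (at_left \<infinity>)"
    unfolding ereal_tendsto_simps by (rule tendsto_poly_times_0)
  have "((\<lambda>x::real. x powr (\<alpha> + 1) * exp (- x)) \<longlongrightarrow> 0) (at_right 0)"
    using \<alpha> by real_asymp
  then have "((\<lambda>x. complex_of_real (x powr (\<alpha> + 1) * exp (- x))) \<longlongrightarrow> of_real 0) (at_right 0)"
    by (rule tendsto_of_real)
  then have "((\<lambda>x. poly (pearson_q (Laguerre \<alpha>)) (complex_of_real x) * of_real (weight (Laguerre \<alpha>) x)) \<longlongrightarrow> of_real 0) (at_right 0)"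
    by (rule Lim_transform_eventually) (auto simp: eventually_at_filter powr_add)
  then have "((\<lambda>x. poly (pearson_q (Laguerre \<alpha>) * u) (complex_of_real x) * of_real (weight (Laguerre \<alpha>) x)) \<longlongrightarrow> 0) (at_right 0)"
    by (intro tendsto_poly_times_0_at) simp
  then show "(((\<lambda>x. poly (pearson_q (Laguerre \<alpha>) * u) (complex_of_real x) * of_real (weight (Laguerre \<alpha>) x)) \<circ> real_of_ereal) \<longlongrightarrow> 0) (at_right 0)"
    unfolding zero_ereal_def ereal_tendsto_simps .
qed (use integrable_poly_Laguerre[OF \<alpha>] in simp_all)

lemma pearson_Jacobi:
  assumes \<alpha>: "\<alpha> > -1" and \<beta>: "\<beta> > -1"
  shows "(LINT x|lborel. poly (pearson_q (Jacobi \<alpha> \<beta>) * pderiv u + pearson_r (Jacobi \<alpha> \<beta>) * u) (complex_of_real x)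
     * of_real (weight (Jacobi \<alpha> \<beta>) x)) = 0"
proof (rule integral_pearson[where a = "-1" and b = 1 and
      w' = "\<lambda>x. (\<beta> / (1 + x) - \<alpha> / (1 - x)) * ((1 - x) powr \<alpha> * (1 + x) powr \<beta>)"])
  fix x assume "- 1 < ereal x" "ereal x < 1"
  then have x: "-1 < x" "x < 1" by (simp_all add: one_ereal_def)
  have "((\<lambda>x. (1 - x) powr \<alpha> * (1 + x) powr \<beta>) has_real_derivative
      (\<beta> / (1 + x) - \<alpha> / (1 - x)) * ((1 - x) powr \<alpha> * (1 + x) powr \<beta>)) (at x)"
    using x by (auto intro!: derivative_eq_intros simp: powr_diff field_simps)
  then show "(weight (Jacobi \<alpha> \<beta>) has_real_derivative (\<beta> / (1 + x) - \<alpha> / (1 - x)) * ((1 - x) powr \<alpha> * (1 + x) powr \<beta>)) (at x)"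
    by (rule has_field_derivative_transform_within_open[where S = "{-1<..<1}"]) (use x in auto)
  have "(1 - x\<^sup>2) * (\<beta> / (1 + x) - \<alpha> / (1 - x)) = \<beta> - \<alpha> - (\<alpha> + \<beta>) * x"
  proof -
    have nz: "1 + x \<noteq> 0" "1 - x \<noteq> 0" using x by auto
    have "(1 - x\<^sup>2) * (\<beta> / (1 + x) - \<alpha> / (1 - x)) = (1 - x) * (\<beta> / (1 + x) * (1 + x)) - (1 + x) * (\<alpha> / (1 - x) * (1 - x))"
      by (simp only: power2_eq_square) algebra
    also have "\<dots> = (1 - x) * \<beta> - (1 + x) * \<alpha>" using nz by simp
    finally show ?thesis by (simp add: algebra_simps)
  qed
  then have "of_real ((1 - x\<^sup>2) * (\<beta> / (1 + x) - \<alpha> / (1 - x))) = complex_of_real (\<beta> - \<alpha> - (\<alpha> + \<beta>) * x)"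
    by (rule arg_cong)
  then have *: "(1 - (of_real x)\<^sup>2) * of_real (\<beta> / (1 + x) - \<alpha> / (1 - x)) = complex_of_real (\<beta> - \<alpha> - (\<alpha> + \<beta>) * x)"
    by simp
  have "poly (pearson_q (Jacobi \<alpha> \<beta>)) (complex_of_real x) = 1 - (of_real x)\<^sup>2"
    by (simp add: power2_eq_square)
  moreover have "poly (pearson_r (Jacobi \<alpha> \<beta>)) (of_real x) - poly (pderiv (pearson_q (Jacobi \<alpha> \<beta>))) (of_real x)
      = complex_of_real (\<beta> - \<alpha> - (\<alpha> + \<beta>) * x)"
    by (simp add: pderiv_pCons algebra_simps)
  ultimately show "poly (pearson_q (Jacobi \<alpha> \<beta>)) (of_real x) * of_real ((\<beta> / (1 + x) - \<alpha> / (1 - x)) * ((1 - x) powr \<alpha> * (1 + x) powr \<beta>)) =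
      (poly (pearson_r (Jacobi \<alpha> \<beta>)) (of_real x) - poly (pderiv (pearson_q (Jacobi \<alpha> \<beta>))) (of_real x)) * complex_of_real (weight (Jacobi \<alpha> \<beta>) x)"
    using x by (simp only: of_real_mult mult.assoc [symmetric] * weight.simps if_True simp_thms)
next
  have q: "poly (pearson_q (Jacobi \<alpha> \<beta>)) (complex_of_real x) * of_real (weight (Jacobi \<alpha> \<beta>) x) =
      of_real ((1 - x) powr (\<alpha> + 1) * (1 + x) powr (\<beta> + 1))" if "-1 < x" "x < 1" for x
    using that by (simp add: powr_add algebra_simps)
  have "((\<lambda>x::real. (1 - x) powr (\<alpha> + 1) * (1 + x) powr (\<beta> + 1)) \<longlongrightarrow> 0) (at_left 1)"
    using \<alpha> by real_asymp
  then have "((\<lambda>x. complex_of_real ((1 - x) powr (\<alpha> + 1) * (1 + x) powr (\<beta> + 1))) \<longlongrightarrow> of_real 0) (at_left 1)"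
    by (rule tendsto_of_real)
  then have "((\<lambda>x. poly (pearson_q (Jacobi \<alpha> \<beta>)) (complex_of_real x) * of_real (weight (Jacobi \<alpha> \<beta>) x)) \<longlongrightarrow> of_real 0) (at_left 1)"
    by (rule Lim_transform_eventually)
      (auto intro: eventually_mono[OF eventually_at_left_real[of "-1" 1]] simp del: pearson_q.simps weight.simps simp: q)
  then have "((\<lambda>x. poly (pearson_q (Jacobi \<alpha> \<beta>) * u) (complex_of_real x) * of_real (weight (Jacobi \<alpha> \<beta>) x)) \<longlongrightarrow> 0) (at_left 1)"
    by (intro tendsto_poly_times_0_at) simp
  then show "(((\<lambda>x. poly (pearson_q (Jacobi \<alpha> \<beta>) * u) (complex_of_real x) * of_real (weight (Jacobi \<alpha> \<beta>) x)) \<circ> real_of_ereal) \<longlongrightarrow> 0) (at_left 1)"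
    unfolding one_ereal_def ereal_tendsto_simps .
  have "((\<lambda>x::real. (1 - x) powr (\<alpha> + 1) * (1 + x) powr (\<beta> + 1)) \<longlongrightarrow> 0) (at_right (-1))"
    using \<beta> by real_asymp
  then have "((\<lambda>x. complex_of_real ((1 - x) powr (\<alpha> + 1) * (1 + x) powr (\<beta> + 1))) \<longlongrightarrow> of_real 0) (at_right (-1))"
    by (rule tendsto_of_real)
  then have "((\<lambda>x. poly (pearson_q (Jacobi \<alpha> \<beta>)) (complex_of_real x) * of_real (weight (Jacobi \<alpha> \<beta>) x)) \<longlongrightarrow> of_real 0) (at_right (-1))"
    by (rule Lim_transform_eventually)
      (auto intro: eventually_mono[OF eventually_at_right_real[of "-1" 1]] simp del: pearson_q.simps weight.simps simp: q)
  then have "((\<lambda>x. poly (pearson_q (Jacobi \<alpha> \<beta>) * u) (complex_of_real x) * of_real (weight (Jacobi \<alpha> \<beta>) x)) \<longlongrightarrow> 0) (at_right (-1))"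
    by (intro tendsto_poly_times_0_at) simp
  then show "(((\<lambda>x. poly (pearson_q (Jacobi \<alpha> \<beta>) * u) (complex_of_real x) * of_real (weight (Jacobi \<alpha> \<beta>) x)) \<circ> real_of_ereal) \<longlongrightarrow> 0) (at_right (-1))"
    unfolding one_ereal_def uminus_ereal.simps ereal_tendsto_simps .
qed (use integrable_poly_Jacobi[OF \<alpha> \<beta>] in \<open>auto simp: one_ereal_def\<close>)

lemma pearson_weight:
  "admissible w \<Longrightarrow>
   (LINT x|lborel. poly (pearson_q w * pderiv u + pearson_r w * u) (complex_of_real x) * of_real (weight w x)) = 0"
  by (cases w) (simp_all only: admissible.simps pearson_Hermite pearson_Laguerre pearson_Jacobi)

section \<open>Eigenpolynomials of the classical operators\<close>

definition classical_op :: "classical_weight \<Rightarrow> diffop" where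
  "classical_op w = [:0, pearson_r w, pearson_q w:]"

fun eigval :: "classical_weight \<Rightarrow> nat \<Rightarrow> real" where
  "eigval (Hermite b) n = - 2 * real n"
| "eigval (Laguerre \<alpha>) n = - real n"
| "eigval (Jacobi \<alpha> \<beta>) n = - real n * (real n + \<alpha> + \<beta> + 1)"

text \<open>
  For Jacobi weights, \<open>\<lambda>_m - \<lambda>_n\<close> has the factor \<open>m + n + \<alpha> + \<beta> + 1\<close>, which is positive for
  \<open>m \<noteq> n\<close> because then \<open>m + n \<ge> 1\<close> while \<open>\<alpha> + \<beta> > -2\<close>.
\<close>

lemma eigval_inj:
  assumes "admissible w" "eigval w m = eigval w n"
  shows "m = n"
proof (cases w)
  case (Jacobi \<alpha> \<beta>)
  show ?thesis
  proof (rule ccontr)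
    assume "m \<noteq> n"
    then have "real m + real n \<ge> 1" by linarith
    then have "real m + real n + \<alpha> + \<beta> + 1 > 0" using assms(1) Jacobi by simp
    moreover have "(real m - real n) * (real m + real n + \<alpha> + \<beta> + 1) = 0"
      using assms(2) Jacobi by (simp add: algebra_simps)
    ultimately show False using \<open>m \<noteq> n\<close> by simp
  qed
qed (use assms(2) in auto)

text \<open>
  \<open>\<delta>_w\<close> is triangular on the powers of \<open>x\<close>, with the eigenvalues on the diagonal.
\<close>

lemma coeff_act_classical_op:
  assumes "degree p \<le> n"
  shows "coeff (act p (classical_op w)) n = of_real (eigval w n) * coeff p n"
proof -
  have z: "coeff p (Suc n) = 0" "coeff p (Suc (Suc n)) = 0"
    using assms by (simp_all add: coeff_eq_0)
  show ?thesis
  proof (cases n)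
    case 0
    then show ?thesis using z
      by (cases w) (simp_all add: classical_op_def act_second_order coeff_pderiv)
  next
    case (Suc m)
    then show ?thesis using z
      by (cases w; cases m) (simp_all add: classical_op_def act_second_order coeff_pderiv algebra_simps)
  qed
qed

lemma coeff_act_classical_op_above:
  assumes "degree p \<le> n" "n < k"
  shows "coeff (act p (classical_op w)) k = 0"
  using coeff_act_classical_op[of p k w] assms by (simp add: coeff_eq_0)

text \<open>
  Below degree \<open>n\<close> the triangular operator \<open>\<delta>_w - \<lambda>_n\<close> has nonzero diagonal entries
  \<open>\<lambda>_k - \<lambda>_n\<close>, so it can be inverted by cancelling the top coefficient again and again.
\<close>

lemma classical_op_minus_eigval_solvable:
  assumes "admissible w" "d \<le> n" "\<And>k. k \<ge> d \<Longrightarrow> coeff f k = 0"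
  shows "\<exists>g. (\<forall>k\<ge>d. coeff g k = 0) \<and> act g (classical_op w) - smult (of_real (eigval w n)) g = f"
  using assms(2,3)
proof (induction d arbitrary: f)
  case 0
  then have "f = 0" by (simp add: poly_eq_iff)
  then show ?case by (intro exI[of _ 0]) simp
next
  case (Suc d)
  let ?l = "\<lambda>k. complex_of_real (eigval w k)"
  let ?A = "\<lambda>g. act g (classical_op w) - smult (?l n) g"
  have ne: "?l d - ?l n \<noteq> 0"
    using eigval_inj[OF assms(1), of d n] Suc.prems(1) by auto
  define g0 where "g0 = monom (coeff f d / (?l d - ?l n)) d"
  have deg: "degree g0 \<le> d" unfolding g0_def by (rule degree_monom_le)
  have "coeff (f - ?A g0) k = 0" if "k \<ge> d" for k
  proof (cases "k = d")
    case True
    have "coeff (?A g0) d = (?l d - ?l n) * coeff g0 d"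
      using coeff_act_classical_op[OF deg, of w] by (simp add: algebra_simps)
    then show ?thesis using ne True by (simp add: g0_def)
  next
    case False
    then show ?thesis
      using that deg Suc.prems(2)[of k] coeff_act_classical_op_above[OF deg, of k w]
      by (simp add: g0_def)
  qed
  then obtain g where g: "\<forall>k\<ge>d. coeff g k = 0" "?A g = f - ?A g0"
    using Suc.IH[of "f - ?A g0"] Suc.prems(1) by auto
  have "?A (g + g0) = ?A g + ?A g0"
    by (simp add: act_add_left smult_add_right)
  also have "\<dots> = f" unfolding g(2) by simp
  finally have "?A (g + g0) = f" .
  moreover have "\<forall>k\<ge>Suc d. coeff (g + g0) k = 0"
    using g(1) by (simp add: g0_def)
  ultimately show ?case by blast
qed

text \<open>
  \<open>\<delta>_w - \<lambda>_n\<close> lowers the degree of \<open>x^n\<close>, and the result is cancelled by a polynomial of degree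
  below \<open>n\<close>.
\<close>

lemma ex_eigenpoly:
  assumes "admissible w"
  shows "\<exists>p. degree p = n \<and> lead_coeff p = 1 \<and>
    act p (classical_op w) = smult (of_real (eigval w n)) p"
proof -
  let ?A = "\<lambda>g. act g (classical_op w) - smult (of_real (eigval w n)) g"
  let ?x = "monom 1 n :: complex poly"
  have deg: "degree ?x \<le> n" by (rule degree_monom_le)
  have "coeff (- ?A ?x) k = 0" if "k \<ge> n" for k
  proof (cases "k = n")
    case True
    then show ?thesis using coeff_act_classical_op[OF deg, of w] by simp
  next
    case False
    then show ?thesis using that coeff_act_classical_op_above[OF deg, of k w] by simp
  qed
  then obtain g where g: "\<forall>k\<ge>n. coeff g k = 0" "?A g = - ?A ?x"
    using classical_op_minus_eigval_solvable[OF assms order.refl, of n "- ?A ?x"] by blast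
  have "?A (?x + g) = ?A ?x + ?A g"
    by (simp add: act_add_left smult_add_right)
  also have "\<dots> = 0" unfolding g(2) by simp
  finally have "?A (?x + g) = 0" .
  moreover have "degree (?x + g) = n"
  proof (rule antisym)
    show "degree (?x + g) \<le> n" using g(1) by (intro degree_le) auto
    show "n \<le> degree (?x + g)" using g(1) by (intro le_degree) simp
  qed
  moreover have "coeff (?x + g) n = 1" using g(1) by simp
  ultimately show ?thesis by (intro exI[of _ "?x + g"]) simp
qed

definition eigenpoly :: "classical_weight \<Rightarrow> nat \<Rightarrow> complex poly" where
  "eigenpoly w n = (SOME p. degree p = n \<and> lead_coeff p = 1 \<and>
    act p (classical_op w) = smult (of_real (eigval w n)) p)"

lemma
  assumes "admissible w"
  shows degree_eigenpoly: "degree (eigenpoly w n) = n"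
    and coeff_eigenpoly: "coeff (eigenpoly w n) n = 1"
    and act_eigenpoly: "act (eigenpoly w n) (classical_op w) = smult (of_real (eigval w n)) (eigenpoly w n)"
  using someI_ex[OF ex_eigenpoly[OF assms, of n]] unfolding eigenpoly_def by auto

lemma eigenpoly_nonzero: "admissible w \<Longrightarrow> eigenpoly w n \<noteq> 0"
  using coeff_eigenpoly[of w n] by auto

text \<open>
  A difference of degree \<open>d < n\<close> would be an eigenvector with eigenvalue \<open>\<lambda>_d = \<lambda>_n\<close>.
\<close>

lemma eigenpoly_unique:
  assumes "admissible w" "degree p \<le> n"
    and "act p (classical_op w) = smult (of_real (eigval w n)) p"
  shows "p = smult (coeff p n) (eigenpoly w n)"
proof -
  define g where "g = p - smult (coeff p n) (eigenpoly w n)"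
  have g: "act g (classical_op w) = smult (of_real (eigval w n)) g"
    using act_eigenpoly[OF assms(1), of n] assms(3)
    by (simp add: g_def act_diff_left act_smult_left smult_diff_right mult.commute)
  have "degree g \<le> n"
    unfolding g_def using assms(2) degree_eigenpoly[OF assms(1), of n]
    by (intro degree_diff_le) auto
  moreover have "coeff g n = 0" by (simp add: g_def coeff_eigenpoly[OF assms(1)])
  ultimately have lt: "g \<noteq> 0 \<Longrightarrow> degree g < n"
    by (metis leading_coeff_0_iff le_neq_implies_less)
  have "g = 0"
  proof (rule ccontr)
    assume nz: "g \<noteq> 0"
    have "of_real (eigval w n) * lead_coeff g = of_real (eigval w (degree g)) * lead_coeff g"
      using coeff_act_classical_op[of g "degree g" w] unfolding g by simp
    then have "eigval w n = eigval w (degree g)" using nz by simp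
    then show False using eigval_inj[OF assms(1)] lt[OF nz] by fastforce
  qed
  then show ?thesis by (simp add: g_def)
qed

section \<open>Orthogonality and uniqueness\<close>

text \<open>
  On the real line the conjugate of a polynomial is the polynomial with conjugated coefficients, so
  the inner product is the integral of a single polynomial against the weight.
\<close>

lemma scalar_inner_conv:
  "scalar_inner w p q = (LINT x|lborel. poly (p * map_poly cnj q) (complex_of_real x) * of_real (w x))"
  by (simp add: scalar_inner_def mult_ac)

lemma map_poly_cnj_mult: "map_poly cnj (p * q) = map_poly cnj p * map_poly cnj q"
  by (rule poly_eqI) (simp add: coeff_map_poly coeff_mult)

lemma map_poly_cnj_add: "map_poly cnj (p + q) = map_poly cnj p + map_poly cnj q"
  by (rule poly_eqI) (simp add: coeff_map_poly)

lemma map_poly_cnj_diff: "map_poly cnj (p - q) = map_poly cnj p - map_poly cnj q"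
  by (rule poly_eqI) (simp add: coeff_map_poly)

lemma pderiv_map_poly_cnj: "pderiv (map_poly cnj p) = map_poly cnj (pderiv p)"
  by (rule poly_eqI) (simp add: coeff_map_poly coeff_pderiv)

lemma map_poly_cnj_pearson:
  "map_poly cnj (pearson_q w) = pearson_q w" "map_poly cnj (pearson_r w) = pearson_r w"
  by (cases w; simp add: map_poly_pCons map_poly_1)+

lemma act_classical_op_cnj:
  "act (map_poly cnj p) (classical_op w) = map_poly cnj (act p (classical_op w))"
  by (simp add: classical_op_def act_second_order map_poly_cnj_add map_poly_cnj_mult
      pderiv_map_poly_cnj map_poly_cnj_pearson)

context
  fixes w :: classical_weight
  assumes w: "admissible w"
begin

lemma scalar_inner_diff_left:
  "scalar_inner (weight w) (p - p') q = scalar_inner (weight w) p q - scalar_inner (weight w) p' q"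
proof -
  have eq: "poly ((p - p') * s) x * c = poly (p * s) x * c - poly (p' * s) x * c" for s x c
    by (simp add: algebra_simps)
  show ?thesis
    unfolding scalar_inner_conv eq
    by (rule Bochner_Integration.integral_diff) (rule integrable_poly_weight[OF w])+
qed

lemma scalar_inner_diff_right:
  "scalar_inner (weight w) p (q - q') = scalar_inner (weight w) p q - scalar_inner (weight w) p q'"
proof -
  have eq: "poly (p * (s - s')) x * c = poly (p * s) x * c - poly (p * s') x * c" for s s' x c
    by (simp add: algebra_simps)
  show ?thesis
    unfolding scalar_inner_conv map_poly_cnj_diff eq
    by (rule Bochner_Integration.integral_diff) (rule integrable_poly_weight[OF w])+
qed

lemma scalar_inner_add_left:
  "scalar_inner (weight w) (p + p') q = scalar_inner (weight w) p q + scalar_inner (weight w) p' q"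
  using scalar_inner_diff_left[of "p + p'" p' q] by simp

lemma scalar_inner_smult_left:
  "scalar_inner (weight w) (smult c p) q = c * scalar_inner (weight w) p q"
  unfolding scalar_inner_conv by (simp add: mult.assoc)

lemma scalar_inner_zero_left: "scalar_inner (weight w) 0 q = 0"
  and scalar_inner_zero_right: "scalar_inner (weight w) p 0 = 0"
  by (simp_all add: scalar_inner_def)

text \<open>
  The usual Sturm-Liouville argument: \<open>\<lambda>_m - \<lambda>_n\<close> times the integrand has the form
  \<open>(q u' + r u) w\<close>, where \<open>u\<close> is the Wronskian.
\<close>

lemma scalar_inner_eigenpoly:
  assumes "m \<noteq> n"
  shows "scalar_inner (weight w) (eigenpoly w m) (eigenpoly w n) = 0"
proof -
  let ?l = "\<lambda>k. complex_of_real (eigval w k)"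
  define p where "p = eigenpoly w m"
  define r where "r = map_poly cnj (eigenpoly w n)"
  \<comment> \<open>the Wronskian of \<open>p\<close> and \<open>r\<close>\<close>
  define u where "u = pderiv p * r - p * pderiv r"
  have p: "pderiv p * pearson_r w + pderiv (pderiv p) * pearson_q w = smult (?l m) p"
    using act_eigenpoly[OF w, of m] by (simp add: p_def classical_op_def act_second_order)
  have "act r (classical_op w) = map_poly cnj (smult (?l n) (eigenpoly w n))"
    unfolding r_def act_classical_op_cnj act_eigenpoly[OF w] ..
  then have r: "pderiv r * pearson_r w + pderiv (pderiv r) * pearson_q w = smult (?l n) r"
    by (simp add: r_def classical_op_def act_second_order map_poly_smult)
  have "pearson_q w * pderiv u + pearson_r w * u =
      (pderiv p * pearson_r w + pderiv (pderiv p) * pearson_q w) * r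
      - p * (pderiv r * pearson_r w + pderiv (pderiv r) * pearson_q w)"
    by (simp add: u_def pderiv_mult pderiv_diff algebra_simps)
  also have "\<dots> = smult (?l m - ?l n) (p * r)"
    unfolding p r by (simp add: smult_diff_left)
  finally have "(LINT x|lborel. poly (smult (?l m - ?l n) (p * r)) (complex_of_real x) * of_real (weight w x)) = 0"
    using pearson_weight[OF w, of u] by simp
  then have "(?l m - ?l n) * scalar_inner (weight w) (eigenpoly w m) (eigenpoly w n) = 0"
    unfolding scalar_inner_conv p_def r_def by (simp add: mult.assoc)
  moreover have "?l m \<noteq> ?l n" using eigval_inj[OF w] assms by auto
  ultimately show ?thesis by simp
qed

lemma scalar_inner_self_definite:
  "\<exists>r\<ge>0. scalar_inner (weight w) p p = of_real r \<and> (r = 0 \<longrightarrow> p = 0)"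
proof -
  let ?f = "\<lambda>x. (cmod (poly p (complex_of_real x)))\<^sup>2 * weight w x"
  have nonneg: "weight w x \<ge> 0" for x by (cases w) auto
  have eq: "poly (p * map_poly cnj p) (complex_of_real x) * of_real (weight w x) = complex_of_real (?f x)" for x
    by (simp add: complex_mult_cnj cmod_power2)
  have "integrable lborel (\<lambda>x. complex_of_real (?f x))"
    using integrable_poly_weight[OF w, of "p * map_poly cnj p"] unfolding eq .
  then have int: "integrable lborel ?f" by (auto dest: integrable_Re)
  have inner: "scalar_inner (weight w) p p = of_real (LINT x|lborel. ?f x)"
    unfolding scalar_inner_conv eq by (rule integral_complex_of_real)
  moreover have "(LINT x|lborel. ?f x) \<ge> 0"
    by (intro Bochner_Integration.integral_nonneg) (simp add: nonneg)
  moreover have "p = 0" if "(LINT x|lborel. ?f x) = 0"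
  proof (rule ccontr)
    assume "p \<noteq> 0"
    define Z where "Z = {x::real. poly p (complex_of_real x) = 0}"
    have "finite (complex_of_real -` {z. poly p z = 0})"
      using poly_roots_finite[OF \<open>p \<noteq> 0\<close>] by (intro finite_vimageI) (auto simp: inj_def)
    then have "finite Z" by (simp add: Z_def vimage_def)
    then have Z: "AE x in lborel. x \<notin> Z"
      by (intro AE_not_in finite_imp_null_set_lborel)
    have "AE x in lborel. ?f x = 0"
      using that int by (subst (asm) integral_nonneg_eq_0_iff_AE) (auto simp: nonneg)
    then have "AE x in lborel. x \<notin> {0<..<1::real}"
      using Z
    proof eventually_elim
      case (elim x)
      \<comment> \<open>The interval \<open>(0, 1)\<close> lies in the support of every classical weight.\<close>
      have "weight w x > 0" if "0 < x" "x < 1" using that by (cases w) auto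
      then show ?case using elim by (auto simp: Z_def)
    qed
    then have "{0<..<1::real} \<in> null_sets lborel"
      by (subst AE_iff_null_sets) auto
    then show False by (simp add: null_sets_def)
  qed
  ultimately show ?thesis by blast
qed

end

text \<open>
  The inner product of rows of matrix polynomials for the diagonal weight. Working with rows settles
  the uniqueness of the scalar orthogonal polynomials (index type \<open>unit\<close>) and of the
  matrix ones by the same proof.
\<close>

definition vector_inner :: "('n::finite \<Rightarrow> classical_weight) \<Rightarrow> ('n \<Rightarrow> complex poly) \<Rightarrow> ('n \<Rightarrow> complex poly) \<Rightarrow> complex" where
  "vector_inner w u v = (\<Sum>k\<in>UNIV. scalar_inner (weight (w k)) (u k) (v k))"

text \<open>
  The rows of the matrices \<open>P 0, \<dots>, P (n - 1)\<close> span the rows with entries of degree below \<open>n\<close>.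
\<close>

lemma orthogonal_to_lower_degrees:
  fixes w :: "'n::finite \<Rightarrow> classical_weight" and P :: "nat \<Rightarrow> 'n \<Rightarrow> 'n \<Rightarrow> complex poly"
  assumes w: "\<And>k. admissible (w k)"
    and deg: "\<And>n i j. degree (P n i j) \<le> n"
    and monic: "\<And>n i j. coeff (P n i j) n = (if i = j then 1 else 0)"
    and orth: "\<And>m i. m < n \<Longrightarrow> vector_inner w (P m i) x = 0"
    and v: "\<And>i k. k \<ge> n \<Longrightarrow> coeff (v i) k = 0"
  shows "vector_inner w v x = 0"
proof -
  have "vector_inner w v x = 0" if "d \<le> n" "\<And>i k. k \<ge> d \<Longrightarrow> coeff (v i) k = 0" for d v
    using that
  proof (induction d arbitrary: v)
    case 0
    then have "v = (\<lambda>_. 0)" by (intro ext) (simp add: poly_eq_iff)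
    then show ?case by (simp add: vector_inner_def scalar_inner_zero_left[OF w])
  next
    case (Suc d)
    define u where "u = (\<lambda>k. v k - (\<Sum>j\<in>UNIV. smult (coeff (v j) d) (P d j k)))"
    have sum: "scalar_inner (weight (w k)) (\<Sum>j\<in>A. smult (c j) (q j)) y = (\<Sum>j\<in>A. c j * scalar_inner (weight (w k)) (q j) y)"
      for k y c and q :: "'n \<Rightarrow> complex poly" and A
      by (induction A rule: infinite_finite_induct)
        (simp_all add: scalar_inner_zero_left[OF w] scalar_inner_smult_left[OF w]
          scalar_inner_add_left[OF w])
    have "coeff (u i) k = 0" if "k \<ge> d" for i k
    proof (cases "k = d")
      case True
      then show ?thesis by (simp add: u_def coeff_sum monic if_distrib sum.delta cong: if_cong)
    next
      case False
      then have "coeff (P d j i) k = 0" for j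
        using that deg[of d j i] by (intro coeff_eq_0) simp
      then show ?thesis using False that Suc.prems(2)[of k i] by (simp add: u_def coeff_sum)
    qed
    then have "vector_inner w u x = 0" using Suc.prems(1) by (intro Suc.IH) auto
    moreover have "vector_inner w u x = vector_inner w v x - (\<Sum>j\<in>UNIV. coeff (v j) d * vector_inner w (P d j) x)"
    proof -
      have "vector_inner w u x = vector_inner w v x
          - (\<Sum>k\<in>UNIV. \<Sum>j\<in>UNIV. coeff (v j) d * scalar_inner (weight (w k)) (P d j k) (x k))"
        by (simp add: vector_inner_def u_def scalar_inner_diff_left[OF w] sum sum_subtractf)
      also have "(\<Sum>k\<in>UNIV. \<Sum>j\<in>UNIV. coeff (v j) d * scalar_inner (weight (w k)) (P d j k) (x k))
          = (\<Sum>j\<in>UNIV. \<Sum>k\<in>UNIV. coeff (v j) d * scalar_inner (weight (w k)) (P d j k) (x k))"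
        by (rule sum.swap)
      finally show ?thesis by (simp add: vector_inner_def sum_distrib_left)
    qed
    moreover have "vector_inner w (P d j) x = 0" for j
      using Suc.prems(1) by (intro orth) simp
    ultimately show ?case by simp
  qed
  then show ?thesis using v by blast
qed

text \<open>
  The difference \<open>R\<close> of two monic families in degree \<open>n\<close> has degree below \<open>n\<close>, so it is orthogonal to
  both of them and hence to itself.
\<close>

lemma vector_orthogonal_unique:
  fixes w :: "'n::finite \<Rightarrow> classical_weight" and P :: "nat \<Rightarrow> 'n \<Rightarrow> 'n \<Rightarrow> complex poly"
  assumes w: "\<And>k. admissible (w k)"
    and deg: "\<And>n i j. degree (P n i j) \<le> n"
    and monic: "\<And>n i j. coeff (P n i j) n = (if i = j then 1 else 0)"
    and orth: "\<And>m n i j. m \<noteq> n \<Longrightarrow> vector_inner w (P m i) (P n j) = 0"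
  shows "P n i j = (if i = j then eigenpoly (w i) n else 0)"
proof -
  define E where "E = (\<lambda>n i j. if i = j then eigenpoly (w i) n else 0)"
  have E_deg: "degree (E n i j) \<le> n" and E_monic: "coeff (E n i j) n = (if i = j then 1 else 0)" for n i j
    by (simp_all add: E_def degree_eigenpoly[OF w] coeff_eigenpoly[OF w])
  have E_orth: "vector_inner w (E m i) (E n j) = 0" if "m \<noteq> n" for m n i j
    unfolding vector_inner_def E_def
    by (intro sum.neutral) (auto simp: scalar_inner_eigenpoly[OF w that] scalar_inner_zero_left[OF w] scalar_inner_zero_right[OF w])
  define R where "R = (\<lambda>k. P n i k - E n i k)"
  have R: "coeff (R k) l = 0" if "l \<ge> n" for k l
  proof (cases "l = n")
    case False
    then have "coeff (P n i k) l = 0" "coeff (E n i k) l = 0"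
      using that deg[of n i k] E_deg[of n i k] by (auto intro: coeff_eq_0)
    then show ?thesis by (simp add: R_def)
  qed (simp add: R_def monic E_monic)
  have "vector_inner w R (P n i) = 0"
    by (rule orthogonal_to_lower_degrees[OF w deg monic orth R]) auto
  moreover have "vector_inner w R (E n i) = 0"
    by (rule orthogonal_to_lower_degrees[OF w E_deg E_monic E_orth R]) auto
  moreover have "vector_inner w R R = vector_inner w R (P n i) - vector_inner w R (E n i)"
    unfolding vector_inner_def R_def scalar_inner_diff_right[OF w] by (simp add: sum_subtractf)
  ultimately have zero: "vector_inner w R R = 0" by simp
  have "\<forall>k. \<exists>r. r \<ge> 0 \<and> scalar_inner (weight (w k)) (R k) (R k) = of_real r \<and> (r = 0 \<longrightarrow> R k = 0)"
    using scalar_inner_self_definite[OF w] by blast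
  then obtain r where r: "\<And>k. r k \<ge> 0" "\<And>k. scalar_inner (weight (w k)) (R k) (R k) = of_real (r k)"
    "\<And>k. r k = 0 \<Longrightarrow> R k = 0"
    by metis
  have "complex_of_real (\<Sum>k\<in>UNIV. r k) = 0"
    using zero by (simp add: vector_inner_def r(2))
  then have "(\<Sum>k\<in>UNIV. r k) = 0" by (simp only: of_real_eq_0_iff)
  then have "r j = 0" using r(1) by (simp add: sum_nonneg_eq_0_iff)
  then show ?thesis using r(3)[of j] by (simp add: R_def E_def)
qed

lemma monic_orthogonal_iff:
  assumes "admissible w"
  shows "monic_orthogonal (weight w) p \<longleftrightarrow> p = eigenpoly w"
proof
  assume p: "monic_orthogonal (weight w) p"
  show "p = eigenpoly w"
  proof
    fix n
    have deg: "degree (p n) = n" for n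
      using p by (simp add: monic_orthogonal_def)
    moreover have "coeff (p n) n = 1" for n
      using p deg[of n] by (metis monic_orthogonal_def)
    ultimately show "p n = eigenpoly w n"
      using vector_orthogonal_unique[of "\<lambda>_::unit. w" "\<lambda>n _ _. p n" n "()" "()"] p assms
      unfolding monic_orthogonal_def by (auto simp: vector_inner_def UNIV_unit)
  qed
next
  assume "p = eigenpoly w"
  then show "monic_orthogonal (weight w) p"
    using assms by (simp add: monic_orthogonal_def degree_eigenpoly coeff_eigenpoly scalar_inner_eigenpoly)
qed

section \<open>Intertwiners of two classical weights\<close>

definition intertwiners :: "classical_weight \<Rightarrow> classical_weight \<Rightarrow> diffop set" where
  "intertwiners w w' = {D. \<forall>n. \<exists>c. act (eigenpoly w n) D = smult c (eigenpoly w' n)}"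

lemma scalar_D_eq_intertwiners:
  "admissible w \<Longrightarrow> scalar_D (weight w) = intertwiners w w"
  by (simp add: scalar_D_def intertwiners_def monic_orthogonal_iff)

lemma zero_in_intertwiners: "0 \<in> intertwiners w w'"
  by (auto simp: intertwiners_def intro: exI[of _ 0])

lemma one_in_intertwiners: "1 \<in> intertwiners w w"
  by (auto simp: intertwiners_def intro: exI[of _ 1])

lemma diffop_mult_in_intertwiners:
  assumes "D \<in> intertwiners w w'" "D' \<in> intertwiners w' w''"
  shows "D \<odot> D' \<in> intertwiners w w''"
  unfolding intertwiners_def
proof safe
  fix n
  obtain c c' where "act (eigenpoly w n) D = smult c (eigenpoly w' n)"
    "act (eigenpoly w' n) D' = smult c' (eigenpoly w'' n)"
    using assms unfolding intertwiners_def by blast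
  then show "\<exists>c. act (eigenpoly w n) (D \<odot> D') = smult c (eigenpoly w'' n)"
    by (auto simp: act_diffop_mult act_smult_left)
qed

lemma add_smult_in_intertwiners:
  assumes "D \<in> intertwiners w w'" "D' \<in> intertwiners w w'"
  shows "D + smult [:a:] D' \<in> intertwiners w w'"
  unfolding intertwiners_def
proof safe
  fix n
  obtain c c' where "act (eigenpoly w n) D = smult c (eigenpoly w' n)"
    "act (eigenpoly w n) D' = smult c' (eigenpoly w' n)"
    using assms unfolding intertwiners_def by blast
  then show "\<exists>c. act (eigenpoly w n) (D + smult [:a:] D') = smult c (eigenpoly w' n)"
    by (intro exI[of _ "c + a * c'"]) (simp add: act_add_right act_smult_right smult_add_left)
qed

lemma classical_op_in_intertwiners: "admissible w \<Longrightarrow> classical_op w \<in> intertwiners w w"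
  by (auto simp: intertwiners_def act_eigenpoly)

text \<open>
  An intertwiner maps a basis with one element in each degree to a sequence of polynomials of at
  most these degrees.
\<close>

lemma degree_act_intertwiner:
  assumes "admissible w" "admissible w'" "D \<in> intertwiners w w'"
  shows "degree (act p D) \<le> degree p"
proof (induction p rule: poly_basis_induct[of "eigenpoly w"])
  case (step n c p)
  have n: "degree (smult c (eigenpoly w n)) = n"
    using \<open>c \<noteq> 0\<close> by (simp add: degree_eigenpoly[OF assms(1)])
  have "degree (p + smult c (eigenpoly w n)) = n"
  proof (cases "p = 0")
    case False
    then show ?thesis using step(1) n degree_add_eq_right[of p "smult c (eigenpoly w n)"] by simp
  qed (simp only: n add_0)
  moreover obtain d where d: "act (eigenpoly w n) D = smult d (eigenpoly w' n)"
    using assms(3) unfolding intertwiners_def by blast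
  have "degree (act p D) \<le> n"
    using step(1,3) by (cases "p = 0") auto
  then have "degree (act (p + smult c (eigenpoly w n)) D) \<le> n"
    unfolding act_add_left act_smult_left d
    by (intro degree_add_le order.trans[OF degree_smult_le]) (simp_all add: degree_eigenpoly[OF assms(2)])
  ultimately show ?case by simp
qed (simp_all add: degree_eigenpoly eigenpoly_nonzero assms)

text \<open>
  Intertwining of the second-order operators themselves. Unlike membership in \<open>intertwiners\<close>, it
  makes sense for all parameters, admissible or not.
\<close>

definition intertwines :: "diffop \<Rightarrow> classical_weight \<Rightarrow> classical_weight \<Rightarrow> bool" where
  "intertwines D w w' \<longleftrightarrow> (\<forall>p. act (act p (classical_op w)) D = act (act p D) (classical_op w'))"

lemma intertwines_mult: "intertwines D w w' \<Longrightarrow> intertwines D' w' w'' \<Longrightarrow> intertwines (D \<odot> D') w w''"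
  by (simp add: intertwines_def act_diffop_mult)

lemma intertwines_if_intertwiner:
  assumes w: "admissible w" "admissible w'" and ev: "eigval w = eigval w'"
    and D: "D \<in> intertwiners w w'"
  shows "intertwines D w w'"
  unfolding intertwines_def
proof
  fix p
  show "act (act p (classical_op w)) D = act (act p D) (classical_op w')"
  proof (induction p rule: poly_basis_induct[of "eigenpoly w"])
    case (step n c p)
    obtain d where "act (eigenpoly w n) D = smult d (eigenpoly w' n)"
      using D unfolding intertwiners_def by blast
    then show ?case
      using step(3) by (simp add: act_add_left act_smult_left act_eigenpoly w ev mult_ac)
  qed (simp_all add: degree_eigenpoly eigenpoly_nonzero w)
qed

text \<open>
  The image of \<open>p_n\<close> has degree at most \<open>n\<close> and solves the eigenvalue equation of \<open>\<delta>_{w'}\<close>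
  with eigenvalue \<open>\<lambda>_n\<close>; the only such polynomials are the multiples of \<open>p'_n\<close>.
\<close>

lemma intertwiner_if_intertwines:
  assumes w: "admissible w" "admissible w'" and ev: "eigval w = eigval w'"
    and D: "intertwines D w w'" and deg: "\<And>p. degree (act p D) \<le> degree p"
  shows "D \<in> intertwiners w w'"
  unfolding intertwiners_def
proof safe
  fix n
  have "act (act (eigenpoly w n) D) (classical_op w') = smult (of_real (eigval w' n)) (act (eigenpoly w n) D)"
    using D by (simp add: intertwines_def act_eigenpoly[OF w(1)] act_smult_left ev flip: D[unfolded intertwines_def, rule_format])
  then show "\<exists>c. act (eigenpoly w n) D = smult c (eigenpoly w' n)"
    using eigenpoly_unique[OF w(2), of "act (eigenpoly w n) D" n] deg[of "eigenpoly w n"]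
    by (auto simp: degree_eigenpoly[OF w(1)])
qed

lemma intertwiner_leading_coeff:
  assumes w: "admissible w" "admissible w'" and ev: "eigval w = eigval w'"
    and q: "pearson_q w = pearson_q w'" and D: "D \<in> intertwiners w w'"
  shows "2 * pearson_q w * pderiv (lead_coeff D) =
    (of_nat (degree D) * pderiv (pearson_q w) + pearson_r w - pearson_r w') * lead_coeff D"
proof (rule intertwining_leading_coeff)
  show "pderiv (pderiv (pderiv (pearson_q w))) = 0" "pderiv (pderiv (pearson_r w)) = 0"
    by (cases w; simp add: pderiv_pCons)+
  show "act (act p [:0, pearson_r w, pearson_q w:]) D = act (act p D) [:0, pearson_r w', pearson_q w:]" for p
    using intertwines_if_intertwiner[OF w ev D] q by (simp add: intertwines_def classical_op_def)
qed

text \<open>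
  If the orders of all intertwiners have the form \<open>k + 2 i\<close>, where \<open>k\<close> is the order of \<open>T\<close>, then
  \<open>T\<close> generates them: \<open>T \<delta>_{w'}^i\<close> has the same order as \<open>D\<close>, and the leading coefficients of
  both satisfy the same first-order equation, so they are proportional and the leading term of \<open>D\<close>
  can be cancelled.
\<close>

theorem intertwiners_principal:
  assumes w: "admissible w" "admissible w'" and ev: "eigval w = eigval w'"
    and q: "pearson_q w = pearson_q w'" and T: "T \<in> intertwiners w w'" "T \<noteq> 0"
    and par: "\<And>D. D \<in> intertwiners w w' \<Longrightarrow> D \<noteq> 0 \<Longrightarrow> \<exists>i. degree D = degree T + 2 * i"
    and D: "D \<in> intertwiners w w'"
  shows "\<exists>D'\<in>intertwiners w' w'. D = T \<odot> D'"
  using D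
proof (induction "if D = 0 then 0 else Suc (degree D)" arbitrary: D rule: less_induct)
  case less
  show ?case
  proof (cases "D = 0")
    case True
    then show ?thesis by (intro bexI[of _ 0]) (simp_all add: zero_in_intertwiners)
  next
    case False
    then obtain i where i: "degree D = degree T + 2 * i" using par less.prems by blast
    \<comment> \<open>\<open>S\<close> is \<open>\<delta>_{w'}^i\<close>, an operator of order \<open>2 i\<close>.\<close>
    define S where "S = ((\<odot>) (classical_op w') ^^ i) 1"
    have q_nz: "pearson_q w' \<noteq> 0" by (cases w') auto
    then have op: "classical_op w' \<noteq> 0" "degree (classical_op w') = 2"
      by (simp_all add: classical_op_def)
    have S: "S \<in> intertwiners w' w' \<and> S \<noteq> 0 \<and> degree S = 2 * i"
      unfolding S_def
    proof (induction i)
      case (Suc i)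
      let ?S = "((\<odot>) (classical_op w') ^^ i) 1"
      have "degree (classical_op w' \<odot> ?S) = 2 * Suc i"
        using Suc op by (simp add: degree_diffop_mult)
      moreover from this have "classical_op w' \<odot> ?S \<noteq> 0" by auto
      moreover have "classical_op w' \<odot> ?S \<in> intertwiners w' w'"
        using Suc by (intro diffop_mult_in_intertwiners[OF classical_op_in_intertwiners[OF w(2)]]) simp
      ultimately show ?case by simp
    qed (simp add: one_in_intertwiners)
    define H where "H = T \<odot> S"
    have H: "H \<in> intertwiners w w'" "degree H = degree D"
      using S T i by (simp_all add: H_def diffop_mult_in_intertwiners degree_diffop_mult)
    have "H \<noteq> 0"
      using coeff_diffop_mult_top[of T S] S T(2) unfolding H_def by (metis coeff_0 leading_coeff_0_iff no_zero_divisors)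
    have "\<exists>c. lead_coeff D = smult c (lead_coeff H)"
    proof (rule proportional_if_same_log_derivative)
      show "2 * pearson_q w * pderiv (lead_coeff D) =
        (of_nat (degree D) * pderiv (pearson_q w) + pearson_r w - pearson_r w') * lead_coeff D"
        by (rule intertwiner_leading_coeff[OF w ev q less.prems])
      show "2 * pearson_q w * pderiv (lead_coeff H) =
        (of_nat (degree D) * pderiv (pearson_q w) + pearson_r w - pearson_r w') * lead_coeff H"
        using intertwiner_leading_coeff[OF w ev q H(1)] unfolding H(2) .
      show "lead_coeff H \<noteq> 0" using \<open>H \<noteq> 0\<close> by simp
      show "2 * pearson_q w \<noteq> 0" using q_nz q by simp
    qed
    then obtain c where c: "lead_coeff D = smult c (lead_coeff H)" ..
    define E where "E = D + smult [:- c:] H"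
    have E: "E \<in> intertwiners w w'"
      unfolding E_def by (intro add_smult_in_intertwiners less.prems H)
    have "coeff E (degree D) = 0" using c H(2) by (simp add: E_def)
    moreover have "degree E \<le> degree D"
      unfolding E_def using H(2) by (intro degree_add_le order.trans[OF degree_smult_le]) simp_all
    ultimately have "E = 0 \<or> degree E < degree D"
      by (metis le_neq_implies_less leading_coeff_0_iff)
    then have "(if E = 0 then 0 else Suc (degree E)) < (if D = 0 then 0 else Suc (degree D))"
      using False by auto
    then obtain D' where D': "D' \<in> intertwiners w' w'" "E = T \<odot> D'"
      using less.hyps E by blast
    have "D = E + smult [:c:] H" by (simp add: E_def flip: smult_add_left)
    also have "\<dots> = T \<odot> (D' + smult [:c:] S)"
      by (simp add: D'(2) H_def diffop_mult_add_right diffop_mult_smult_right)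
    finally show ?thesis
      using add_smult_in_intertwiners[OF D'(1), of S c] S by blast
  qed
qed

text \<open>
  The leading coefficient satisfies \<open>F' = (b - b') F\<close>; differentiation lowers degrees.
\<close>

lemma nonzero_intertwiner_Hermite_imp_eq:
  assumes "D \<in> intertwiners (Hermite b) (Hermite b')" "D \<noteq> 0"
  shows "b = b'"
proof (rule ccontr)
  assume ne: "b \<noteq> b'"
  define F where "F = lead_coeff D"
  have "2 * 1 * pderiv F = [:of_real (2 * b) - of_real (2 * b'):] * F"
    using intertwiner_leading_coeff[OF _ _ _ _ assms(1)] by (simp add: F_def fun_eq_iff)
  moreover have "2 * 1 * pderiv F = smult 2 (pderiv F)" by (simp add: numeral_poly)
  ultimately have "degree (smult 2 (pderiv F)) = degree (smult (of_real (2 * b) - of_real (2 * b')) F)"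
    by simp
  then have "degree (pderiv F) = degree F" using ne by simp
  then have "degree F = 0" by (simp add: degree_pderiv)
  then have "pderiv F = 0" by (simp add: pderiv_eq_0_iff)
  then have "smult (of_real (2 * b) - of_real (2 * b')) F = 0"
    using \<open>2 * 1 * pderiv F = [:of_real (2 * b) - of_real (2 * b'):] * F\<close> by simp
  then show False using ne assms(2) by (simp add: F_def)
qed

text \<open>
  Here \<open>a\<close> is the order of the leading coefficient \<open>F\<close> at \<open>0\<close>: the equation for \<open>F\<close> is
  \<open>2 x F' = (m + \<alpha> - \<alpha>') F\<close>. The bound \<open>a \<le> m\<close> holds because intertwiners do not raise degrees; it
  makes \<open>m - k = 2 (a - k)\<close> nonnegative when \<open>\<alpha> = \<alpha>' + k\<close>.
\<close>

lemma intertwiner_degree_Laguerre: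
  assumes "D \<in> intertwiners (Laguerre \<alpha>) (Laguerre \<alpha>')" "D \<noteq> 0" "\<alpha> > -1" "\<alpha>' > -1"
  shows "\<exists>a\<le>degree D. 2 * real a = real (degree D) + \<alpha> - \<alpha>'"
proof -
  let ?w = "Laguerre \<alpha>" and ?w' = "Laguerre \<alpha>'"
  define F where "F = lead_coeff D"
  define m where "m = degree D"
  have F: "F \<noteq> 0" using assms(2) by (simp add: F_def)
  have w: "admissible ?w" "admissible ?w'" using assms by simp_all
  have "[:-0, 1:] * 2 * pderiv F = [:of_nat m + of_real (\<alpha> - \<alpha>'):] * F"
    using intertwiner_leading_coeff[OF w _ _ assms(1)]
    by (simp add: F_def m_def fun_eq_iff pderiv_pCons of_nat_poly mult_ac algebra_simps)
  then have "of_nat (order 0 F) * poly 2 0 = poly [:of_nat m + complex_of_real (\<alpha> - \<alpha>'):] 0"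
    using F by (rule order_times_residue)
  then have "complex_of_real (real (order 0 F) * 2) = of_real (real m + (\<alpha> - \<alpha>'))"
    by simp
  then have "2 * real (order 0 F) = real m + \<alpha> - \<alpha>'"
    by (simp only: of_real_eq_iff)
  moreover have "order 0 F \<le> degree F" using F by (rule order_degree)
  moreover have "degree F \<le> m"
    unfolding F_def m_def
    by (rule degree_coeff_le_if_degree_nonincreasing) (rule degree_act_intertwiner[OF w assms(1)])
  ultimately show ?thesis unfolding m_def by (intro exI[of _ "order 0 F"]) auto
qed

text \<open>
  Here \<open>a\<close> and \<open>b\<close> are the orders of the leading coefficient at \<open>1\<close> and at \<open>-1\<close>.
\<close>

lemma intertwiner_degree_Jacobi:
  assumes D: "D \<in> intertwiners (Jacobi \<alpha> \<beta>) (Jacobi \<alpha>' \<beta>')" "D \<noteq> 0"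
    and w: "admissible (Jacobi \<alpha> \<beta>)" "admissible (Jacobi \<alpha>' \<beta>')"
    and sum: "\<alpha> + \<beta> = \<alpha>' + \<beta>'"
  shows "\<exists>a b. 2 * real a = real (degree D) - (\<alpha>' - \<alpha>) \<and> 2 * real b = real (degree D) + (\<alpha>' - \<alpha>)"
proof -
  define F where "F = lead_coeff D"
  define m where "m = degree D"
  have F: "F \<noteq> 0" using D(2) by (simp add: F_def)
  have ev: "eigval (Jacobi \<alpha> \<beta>) = eigval (Jacobi \<alpha>' \<beta>')"
    using sum by (auto simp: fun_eq_iff add.assoc)
  define v where "v = [:complex_of_real (2 * (\<alpha>' - \<alpha>)), - 2 * of_nat m:]"
  have r: "pearson_r (Jacobi \<alpha> \<beta>) - pearson_r (Jacobi \<alpha>' \<beta>') = [:complex_of_real (2 * (\<alpha>' - \<alpha>)):]"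
    using sum by (simp add: algebra_simps flip: of_real_add of_real_diff)
  have v: "of_nat m * pderiv (pearson_q (Jacobi \<alpha> \<beta>)) + pearson_r (Jacobi \<alpha> \<beta>) - pearson_r (Jacobi \<alpha>' \<beta>') = v"
    unfolding add_diff_eq [symmetric] r
    by (simp add: v_def pderiv_pCons of_nat_poly)
  have ode: "2 * [:1, 0, -1:] * pderiv F = v * F"
    using intertwiner_leading_coeff[OF w ev _ D(1)] v by (simp add: F_def m_def)
  \<comment> \<open>\<open>2 (1 - x^2)\<close> with the factor \<open>x - 1\<close>, respectively \<open>x + 1\<close>, split off\<close>
  have "[:-1, 1:] * [:-2, -2:] = 2 * [:1, 0, -1 :: complex:]"
    "[:-(-1), 1:] * [:2, -2:] = 2 * [:1, 0, -1 :: complex:]"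
    by (simp_all add: numeral_poly)
  then have "[:-1, 1:] * [:-2, -2:] * pderiv F = v * F" "[:-(-1), 1:] * [:2, -2:] * pderiv F = v * F"
    using ode by simp_all
  then have "of_nat (order 1 F) * poly [:-2, -2:] 1 = poly v 1" "of_nat (order (-1) F) * poly [:2, -2:] (-1) = poly v (-1)"
    using F by (blast intro: order_times_residue)+
  then have "complex_of_real (real (order 1 F) * -4) = of_real (2 * (\<alpha>' - \<alpha>) - 2 * real m)"
    "complex_of_real (real (order (-1) F) * 4) = of_real (2 * (\<alpha>' - \<alpha>) + 2 * real m)"
    by (simp_all add: v_def)
  then have "real (order 1 F) * -4 = 2 * (\<alpha>' - \<alpha>) - 2 * real m"
    "real (order (-1) F) * 4 = 2 * (\<alpha>' - \<alpha>) + 2 * real m"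
    by (simp_all only: of_real_eq_iff)
  then show ?thesis unfolding m_def
    by (intro exI[of _ "order 1 F"] exI[of _ "order (-1) F"]) auto
qed

section \<open>Jacobi weights with different spectra\<close>

text \<open>
  As polynomials in \<open>n\<close>, the left side has odd degree unless it is zero, and the right side has
  even degree.
\<close>

lemma zero_if_odd_multiple_of_quadratic_composition:
  fixes L \<Phi> \<Xi> :: "complex poly"
  assumes "degree L = 2" and eq: "\<And>n. of_nat n * poly \<Phi> (poly L (of_nat n)) = poly \<Xi> (poly L (of_nat n))"
  shows "\<Phi> = 0"
proof (rule ccontr)
  assume "\<Phi> \<noteq> 0"
  define P where "P = [:0, 1:] * pcompose \<Phi> L - pcompose \<Xi> L"
  have "P = 0"
  proof (rule ccontr)
    assume "P \<noteq> 0"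
    then have "finite {z. poly P z = 0}" by (rule poly_roots_finite)
    moreover have "range of_nat \<subseteq> {z. poly P z = 0}"
      using eq by (auto simp: P_def poly_pcompose)
    ultimately have "finite (range (of_nat :: nat \<Rightarrow> complex))" by (metis finite_subset)
    then have "finite (UNIV :: nat set)" by (rule finite_imageD) (rule inj_of_nat)
    then show False by simp
  qed
  then have eq': "[:0, 1:] * pcompose \<Phi> L = pcompose \<Xi> L" by (simp add: P_def)
  have "pcompose \<Phi> L \<noteq> 0"
    using \<open>\<Phi> \<noteq> 0\<close> assms(1) by (simp add: pcompose_eq_0_iff)
  then have "degree ([:0, 1:] * pcompose \<Phi> L) = Suc (2 * degree \<Phi>)"
    using assms(1) by (simp add: degree_mult_eq degree_pcompose)
  moreover have "degree (pcompose \<Xi> L) = 2 * degree \<Xi>"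
    using assms(1) by (simp add: degree_pcompose)
  ultimately have "Suc (2 * degree \<Phi>) = 2 * degree \<Xi>" unfolding eq' by (rule trans[OF sym])
  then show False by presburger
qed

text \<open>
  At \<open>x = 1\<close> the coefficient \<open>q = 1 - x^2\<close> vanishes, so the \<open>j\<close>-th derivative of the eigenvalue
  equation is a two-term recursion for the derivatives of \<open>p\<close>. It can be solved because the factor
  \<open>-2 (j + \<alpha> + 1)\<close> of the highest derivative is not zero.
\<close>

lemma higher_pderiv_at_1_Jacobi:
  assumes \<alpha>: "\<alpha> > -1"
  shows "\<exists>f. \<forall>p l. act p (classical_op (Jacobi \<alpha> \<beta>)) = smult l p \<longrightarrow>
    poly ((pderiv ^^ j) p) 1 = poly p 1 * poly f l"
proof (induction j)
  case 0
  show ?case by (intro exI[of _ 1]) simp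
next
  case (Suc j)
  let ?w = "Jacobi \<alpha> \<beta>"
  obtain f where f: "\<And>p l. act p (classical_op ?w) = smult l p \<Longrightarrow>
    poly ((pderiv ^^ j) p) 1 = poly p 1 * poly f l" using Suc by blast
  define e where "e = of_nat (j choose 2) * (-2) - of_nat j * complex_of_real (\<alpha> + \<beta> + 2)"
  define d where "d = complex_of_real (- 2 * (real j + \<alpha> + 1))"
  have "d \<noteq> 0" unfolding d_def of_real_eq_0_iff using \<alpha> by simp
  have "poly ((pderiv ^^ Suc j) p) 1 = poly p 1 * poly (smult (1 / d) ([:- e, 1:] * f)) l"
    if p: "act p (classical_op ?w) = smult l p" for p l
  proof -
    have "(pderiv ^^ j) (act p (classical_op ?w)) = smult l ((pderiv ^^ j) p)"
      by (simp add: p higher_pderiv_smult)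
    moreover have "(pderiv ^^ j) (act p (classical_op ?w)) = (pderiv ^^ (j + 2)) p * pearson_q ?w
      + (pderiv ^^ (j + 1)) p * (of_nat j * pderiv (pearson_q ?w) + pearson_r ?w)
      + (pderiv ^^ j) p * (of_nat (j choose 2) * pderiv (pderiv (pearson_q ?w)) + of_nat j * pderiv (pearson_r ?w))"
      unfolding classical_op_def by (rule higher_pderiv_act_second_order) (simp_all add: pderiv_pCons)
    ultimately have "poly ((pderiv ^^ (j + 2)) p * pearson_q ?w
      + (pderiv ^^ (j + 1)) p * (of_nat j * pderiv (pearson_q ?w) + pearson_r ?w)
      + (pderiv ^^ j) p * (of_nat (j choose 2) * pderiv (pderiv (pearson_q ?w)) + of_nat j * pderiv (pearson_r ?w))) 1
      = poly (smult l ((pderiv ^^ j) p)) 1" by simp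
    then have "poly ((pderiv ^^ Suc j) p) 1 * d + poly ((pderiv ^^ j) p) 1 * e = l * poly ((pderiv ^^ j) p) 1"
      by (simp add: d_def e_def pderiv_pCons algebra_simps)
    then have "poly ((pderiv ^^ Suc j) p) 1 * d = (l - e) * (poly p 1 * poly f l)"
      unfolding f[OF p] by (simp add: algebra_simps)
    then show ?thesis using \<open>d \<noteq> 0\<close> by (simp add: field_simps)
  qed
  then show ?case by blast
qed

text \<open>
  Otherwise all derivatives would vanish at \<open>1\<close>, including the \<open>n\<close>-th, which is the constant \<open>n!\<close>.
\<close>

lemma eigenpoly_at_1_Jacobi:
  assumes "admissible (Jacobi \<alpha> \<beta>)"
  shows "poly (eigenpoly (Jacobi \<alpha> \<beta>) n) 1 \<noteq> 0"
proof
  let ?p = "eigenpoly (Jacobi \<alpha> \<beta>) n"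
  assume zero: "poly ?p 1 = 0"
  have "\<alpha> > -1" using assms by simp
  then obtain f where "\<And>p l. act p (classical_op (Jacobi \<alpha> \<beta>)) = smult l p \<Longrightarrow>
      poly ((pderiv ^^ n) p) 1 = poly p 1 * poly f l"
    using higher_pderiv_at_1_Jacobi[of \<alpha> \<beta> n] by blast
  from this[OF act_eigenpoly[OF assms]] have "poly ((pderiv ^^ n) ?p) 1 = 0"
    by (simp add: zero)
  moreover have "degree ((pderiv ^^ n) ?p) = 0"
    by (simp add: degree_higher_pderiv degree_eigenpoly[OF assms])
  then obtain c where c: "(pderiv ^^ n) ?p = [:c:]" by (rule degree_eq_zeroE)
  have "coeff ((pderiv ^^ n) ?p) 0 = fact n"
    by (simp add: coeff_higher_pderiv coeff_eigenpoly[OF assms] pochhammer_fact)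
  ultimately show False by (simp add: c)
qed

text \<open>
  Let \<open>g = p_n \<cdot> D\<close>. Both \<open>g(1)\<close> and \<open>g'(1)\<close> are \<open>p_n(1)\<close> times polynomials \<open>\<Phi>\<close>, \<open>\<Psi>\<close> in
  \<open>\<lambda>_n\<close>. As \<open>g\<close> is a multiple of \<open>p'_n\<close>, also \<open>-2 (\<alpha>' + 1) g'(1) = \<lambda>'_n g(1)\<close>. But
  \<open>\<lambda>'_n = \<lambda>_n - t n\<close> with \<open>t \<noteq> 0\<close> contains an odd power of \<open>n\<close> that the other terms cannot
  produce, so \<open>\<Phi> = 0\<close>, hence \<open>g(1) = 0\<close> and \<open>g = 0\<close>.
\<close>

lemma intertwiner_Jacobi_zero:
  assumes w: "admissible (Jacobi \<alpha> \<beta>)" "admissible (Jacobi \<alpha>' \<beta>')"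
    and ne: "\<alpha> + \<beta> \<noteq> \<alpha>' + \<beta>'" and D: "D \<in> intertwiners (Jacobi \<alpha> \<beta>) (Jacobi \<alpha>' \<beta>')"
  shows "D = 0"
proof -
  let ?w = "Jacobi \<alpha> \<beta>" and ?w' = "Jacobi \<alpha>' \<beta>'"
  let ?l = "\<lambda>n. complex_of_real (eigval ?w n)" and ?l' = "\<lambda>n. complex_of_real (eigval ?w' n)"
  define t where "t = complex_of_real (\<alpha>' + \<beta>' - (\<alpha> + \<beta>))"
  define k where "k = complex_of_real (- 2 * (\<alpha>' + 1))"
  have "t \<noteq> 0" unfolding t_def of_real_eq_0_iff using ne by simp
  have "\<forall>j. \<exists>f. \<forall>p l. act p (classical_op ?w) = smult l p \<longrightarrow> poly ((pderiv ^^ j) p) 1 = poly p 1 * poly f l"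
    using higher_pderiv_at_1_Jacobi w(1) by simp
  then obtain f where f: "\<And>j p l. act p (classical_op ?w) = smult l p \<Longrightarrow>
      poly ((pderiv ^^ j) p) 1 = poly p 1 * poly (f j) l" by metis
  define \<Phi> where "\<Phi> = (\<Sum>j\<le>degree D. smult (poly (coeff D j) 1) (f j))"
  define \<Psi> where "\<Psi> = (\<Sum>j\<le>degree D. smult (poly (coeff D j) 1) (f (Suc j)) + smult (poly (pderiv (coeff D j)) 1) (f j))"
  define P where "P = eigenpoly ?w"
  have fP: "poly ((pderiv ^^ j) (P n)) 1 = poly (P n) 1 * poly (f j) (?l n)" for j n
    unfolding P_def by (rule f) (rule act_eigenpoly[OF w(1)])
  have P1: "poly (P n) 1 \<noteq> 0" for n unfolding P_def by (rule eigenpoly_at_1_Jacobi[OF w(1)])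
  have \<Phi>: "poly (act (P n) D) 1 = poly (P n) 1 * poly \<Phi> (?l n)" for n
    by (simp add: act_def poly_sum fP \<Phi>_def sum_distrib_left mult_ac)
  have \<Psi>: "poly (pderiv (act (P n) D)) 1 = poly (P n) 1 * poly \<Psi> (?l n)" for n
  proof -
    have "poly (pderiv (act (P n) D)) 1 = (\<Sum>j\<le>degree D.
        poly ((pderiv ^^ Suc j) (P n)) 1 * poly (coeff D j) 1 + poly ((pderiv ^^ j) (P n)) 1 * poly (pderiv (coeff D j)) 1)"
      by (simp add: act_def Defs.pderiv_sum pderiv_mult poly_sum algebra_simps)
    then show ?thesis unfolding fP \<Psi>_def by (simp add: poly_sum sum_distrib_left algebra_simps)
  qed
  have ode: "poly (pderiv (act (P n) D)) 1 * k = ?l' n * poly (act (P n) D) 1" for n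
  proof -
    obtain c where c: "act (P n) D = smult c (eigenpoly ?w' n)"
      using D unfolding intertwiners_def P_def by blast
    have "act (act (P n) D) (classical_op ?w') = smult (?l' n) (act (P n) D)"
      unfolding c act_smult_left act_eigenpoly[OF w(2)] by (simp add: mult.commute)
    then have "poly (act (act (P n) D) (classical_op ?w')) 1 = poly (smult (?l' n) (act (P n) D)) 1" by simp
    then show ?thesis by (simp add: classical_op_def act_second_order k_def algebra_simps)
  qed
  have l': "?l' n = ?l n - t * of_nat n" for n
    unfolding t_def by (simp add: algebra_simps)
  have "t * of_nat n * poly \<Phi> (?l n) = ?l n * poly \<Phi> (?l n) - k * poly \<Psi> (?l n)" for n
  proof -
    have cancel: "t * m * x = l * x - k * y" if "p * y * k = (l - t * m) * (p * x)" "p \<noteq> 0" for p x y l m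
    proof -
      have "p * (t * m * x) = p * (l * x - k * y)" using that(1) by (simp add: algebra_simps)
      then show ?thesis using that(2) by simp
    qed
    show ?thesis
      using ode[of n] P1[of n] unfolding \<Phi> \<Psi> l' by (rule cancel)
  qed
  then have "of_nat n * poly (smult t \<Phi>) (?l n) = poly ([:0, 1:] * \<Phi> - smult k \<Psi>) (?l n)" for n
    by (simp add: mult_ac)
  moreover have "?l n = poly [:0, - of_real (\<alpha> + \<beta> + 1), -1:] (of_nat n)" for n
    by (simp add: algebra_simps)
  ultimately have "of_nat n * poly (smult t \<Phi>) (poly [:0, - of_real (\<alpha> + \<beta> + 1), -1:] (of_nat n)) =
      poly ([:0, 1:] * \<Phi> - smult k \<Psi>) (poly [:0, - of_real (\<alpha> + \<beta> + 1), -1:] (of_nat n))" for n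
    by metis
  then have "smult t \<Phi> = 0"
    by (rule zero_if_odd_multiple_of_quadratic_composition[rotated]) simp
  then have "\<Phi> = 0" using \<open>t \<noteq> 0\<close> by simp
  then have zero: "act (P n) D = 0" for n
  proof -
    obtain c where c: "act (P n) D = smult c (eigenpoly ?w' n)"
      using D unfolding intertwiners_def P_def by blast
    have "poly (act (P n) D) 1 = 0" using \<Phi>[of n] \<open>\<Phi> = 0\<close> by simp
    then have "c = 0" unfolding c using eigenpoly_at_1_Jacobi[OF w(2), of n] by simp
    then show ?thesis by (simp add: c)
  qed
  show ?thesis
  proof (rule act_eq_0_imp)
    show "act p D = 0" for p
      by (induction p rule: poly_basis_induct[of P])
        (simp_all add: P_def degree_eigenpoly[OF w(1)] eigenpoly_nonzero[OF w(1)] act_add_left act_smult_left zero[unfolded P_def])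
  qed
qed

section \<open>The explicit intertwiners\<close>

lemma degree_preserving_mult:
  "degree_preserving D \<Longrightarrow> degree_preserving D' \<Longrightarrow> degree_preserving (D \<odot> D')"
  by (simp add: degree_preserving_def act_diffop_mult)

lemma degree_preserving_one: "degree_preserving 1"
  by (simp add: degree_preserving_def)

lemma degree_preserving_nonzero: "degree_preserving D \<Longrightarrow> D \<noteq> 0"
  unfolding degree_preserving_def using act_0_right[of 1] by (metis one_neq_zero)

text \<open>
  On \<open>x^n\<close> the operator \<open>c + \<partial> (g0 + g1 x)\<close> acts with diagonal entry \<open>c + n g1\<close>.
\<close>

lemma degree_preserving_first_order:
  assumes "\<And>n. c + of_nat n * g1 \<noteq> 0"
  shows "degree_preserving [: [:c:], [:g0, g1:] :]"
proof -
  have coeff: "coeff (act p [: [:c:], [:g0, g1:] :]) n = (c + of_nat n * g1) * coeff p n" if "degree p \<le> n" for p n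
  proof -
    have "coeff p (Suc n) = 0" using that by (simp add: coeff_eq_0)
    then show ?thesis
      by (cases n) (simp_all add: act_first_order coeff_pderiv algebra_simps)
  qed
  have "degree (act p [: [:c:], [:g0, g1:] :]) = degree p \<and> (p \<noteq> 0 \<longrightarrow> act p [: [:c:], [:g0, g1:] :] \<noteq> 0)" for p
  proof (cases "p = 0")
    case False
    then have nz: "coeff (act p [: [:c:], [:g0, g1:] :]) (degree p) \<noteq> 0"
      using assms[of "degree p"] coeff[of p "degree p"] by simp
    have "coeff (act p [: [:c:], [:g0, g1:] :]) n = 0" if "n > degree p" for n
      using coeff[of p n] that by (simp add: coeff_eq_0)
    then have "degree (act p [: [:c:], [:g0, g1:] :]) \<le> degree p" by (intro degree_le) auto
    then show ?thesis using nz by (auto intro: antisym le_degree)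
  qed simp
  then show ?thesis by (simp add: degree_preserving_def)
qed

text \<open>
  Each factor of the explicit operators shifts the parameters by one.
\<close>

lemma intertwines_laguerre_up_step:
  "intertwines [:-1, 1:] (Laguerre \<alpha>) (Laguerre (\<alpha> + 1))"
  unfolding intertwines_def classical_op_def act_second_order act_first_order
  by (subst poly_eq_poly_eq_iff [symmetric])
    (simp add: fun_eq_iff pderiv_mult pderiv_add pderiv_diff pderiv_smult pderiv_minus pderiv_pCons algebra_simps)

lemma intertwines_laguerre_down_step:
  "intertwines [: [:of_real a:], [:0, 1:] :] (Laguerre a) (Laguerre (a - 1))"
  unfolding intertwines_def classical_op_def act_second_order act_first_order
  by (subst poly_eq_poly_eq_iff [symmetric])
    (simp add: fun_eq_iff pderiv_mult pderiv_add pderiv_diff pderiv_smult pderiv_minus pderiv_pCons algebra_simps)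

lemma intertwines_jacobi_up_step:
  "intertwines [: [:of_real b:], [:1, 1:] :] (Jacobi a b) (Jacobi (a + 1) (b - 1))"
  unfolding intertwines_def classical_op_def act_second_order act_first_order
  by (subst poly_eq_poly_eq_iff [symmetric])
    (simp add: fun_eq_iff pderiv_mult pderiv_add pderiv_diff pderiv_smult pderiv_minus pderiv_pCons algebra_simps)

lemma intertwines_jacobi_down_step:
  "intertwines [: [:of_real a:], [:-1, 1:] :] (Jacobi a b) (Jacobi (a - 1) (b + 1))"
  unfolding intertwines_def classical_op_def act_second_order act_first_order
  by (subst poly_eq_poly_eq_iff [symmetric])
    (simp add: fun_eq_iff pderiv_mult pderiv_add pderiv_diff pderiv_smult pderiv_minus pderiv_pCons algebra_simps)

lemma intertwines_one: "intertwines 1 w w"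
  by (simp add: intertwines_def)

lemma laguerre_up_intertwines:
  "intertwines (laguerre_up k) (Laguerre \<alpha>) (Laguerre (\<alpha> + real k)) \<and>
   degree_preserving (laguerre_up k) \<and> degree (laguerre_up k) = k"
proof (induction k arbitrary: \<alpha>)
  case 0
  show ?case by (simp add: laguerre_up_def diffop_prod_def intertwines_one degree_preserving_one)
next
  case (Suc k)
  have eq: "laguerre_up (Suc k) = [:-1, 1:] \<odot> laguerre_up k"
    by (simp add: laguerre_up_def diffop_prod_def)
  have "intertwines (laguerre_up (Suc k)) (Laguerre \<alpha>) (Laguerre (\<alpha> + 1 + real k))"
    unfolding eq using Suc by (intro intertwines_mult[OF intertwines_laguerre_up_step]) simp
  moreover have "degree_preserving [: [:-1:], [:1, 0:] :]"
    by (rule degree_preserving_first_order) simp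
  then have "degree_preserving [:-1, 1:]" by (simp add: one_pCons)
  moreover have "laguerre_up k \<noteq> 0" using Suc degree_preserving_nonzero by blast
  ultimately show ?case
    using Suc[of \<alpha>] by (simp add: eq degree_preserving_mult degree_diffop_mult add_ac)
qed

lemma laguerre_down_intertwines:
  assumes "\<alpha> > -1"
  shows "intertwines (laguerre_down \<alpha> k) (Laguerre (\<alpha> + real k)) (Laguerre \<alpha>) \<and>
   degree_preserving (laguerre_down \<alpha> k) \<and> degree (laguerre_down \<alpha> k) = k"
proof (induction k)
  case 0
  show ?case by (simp add: laguerre_down_def diffop_prod_def intertwines_one degree_preserving_one)
next
  case (Suc k)
  let ?N = "[: [:of_real (\<alpha> + real (Suc k)):], [:0, 1:] :]"
  have eq: "laguerre_down \<alpha> (Suc k) = ?N \<odot> laguerre_down \<alpha> k"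
    by (simp add: laguerre_down_def diffop_prod_def)
  have "intertwines ?N (Laguerre (\<alpha> + real (Suc k))) (Laguerre (\<alpha> + real (Suc k) - 1))"
    by (rule intertwines_laguerre_down_step)
  then have "intertwines (laguerre_down \<alpha> (Suc k)) (Laguerre (\<alpha> + real (Suc k))) (Laguerre \<alpha>)"
    unfolding eq using Suc by (intro intertwines_mult[where w' = "Laguerre (\<alpha> + real k)"]) simp_all
  moreover have "degree_preserving ?N"
  proof (rule degree_preserving_first_order)
    fix n
    have "complex_of_real (\<alpha> + real (Suc k) + real n) \<noteq> 0"
      unfolding of_real_eq_0_iff using assms by simp
    then show "complex_of_real (\<alpha> + real (Suc k)) + of_nat n * 1 \<noteq> 0" by simp
  qed
  moreover have "laguerre_down \<alpha> k \<noteq> 0" using Suc degree_preserving_nonzero by blast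
  ultimately show ?case
    using Suc by (simp only: eq) (simp add: degree_preserving_mult degree_diffop_mult)
qed

lemma jacobi_up_intertwines:
  assumes "\<beta> > -1"
  shows "intertwines (jacobi_up \<beta> k) (Jacobi a (\<beta> + real k)) (Jacobi (a + real k) \<beta>) \<and>
   degree_preserving (jacobi_up \<beta> k) \<and> degree (jacobi_up \<beta> k) = k"
proof (induction k arbitrary: a)
  case 0
  show ?case by (simp add: jacobi_up_def diffop_prod_def intertwines_one degree_preserving_one)
next
  case (Suc k)
  let ?V = "[: [:of_real (\<beta> + real (Suc k)):], [:1, 1:] :]"
  have eq: "jacobi_up \<beta> (Suc k) = ?V \<odot> jacobi_up \<beta> k"
    by (simp add: jacobi_up_def diffop_prod_def)
  have "intertwines ?V (Jacobi a (\<beta> + real (Suc k))) (Jacobi (a + 1) (\<beta> + real (Suc k) - 1))"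
    by (rule intertwines_jacobi_up_step)
  then have "intertwines (jacobi_up \<beta> (Suc k)) (Jacobi a (\<beta> + real (Suc k))) (Jacobi (a + 1 + real k) \<beta>)"
    unfolding eq using Suc by (intro intertwines_mult[where w' = "Jacobi (a + 1) (\<beta> + real k)"]) simp_all
  moreover have "degree_preserving ?V"
  proof (rule degree_preserving_first_order)
    fix n
    have "complex_of_real (\<beta> + real (Suc k) + real n) \<noteq> 0"
      unfolding of_real_eq_0_iff using assms by simp
    then show "complex_of_real (\<beta> + real (Suc k)) + of_nat n * 1 \<noteq> 0" by simp
  qed
  moreover have "jacobi_up \<beta> k \<noteq> 0" using Suc degree_preserving_nonzero by blast
  ultimately show ?case
    using Suc by (simp only: eq) (simp add: degree_preserving_mult degree_diffop_mult add_ac)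
qed

lemma jacobi_down_intertwines:
  assumes "\<alpha> > -1"
  shows "intertwines (jacobi_down \<alpha> k) (Jacobi (\<alpha> + real k) b) (Jacobi \<alpha> (b + real k)) \<and>
   degree_preserving (jacobi_down \<alpha> k) \<and> degree (jacobi_down \<alpha> k) = k"
proof (induction k arbitrary: b)
  case 0
  show ?case by (simp add: jacobi_down_def diffop_prod_def intertwines_one degree_preserving_one)
next
  case (Suc k)
  let ?M = "[: [:of_real (\<alpha> + real (Suc k)):], [:-1, 1:] :]"
  have eq: "jacobi_down \<alpha> (Suc k) = ?M \<odot> jacobi_down \<alpha> k"
    by (simp add: jacobi_down_def diffop_prod_def)
  have "intertwines ?M (Jacobi (\<alpha> + real (Suc k)) b) (Jacobi (\<alpha> + real (Suc k) - 1) (b + 1))"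
    by (rule intertwines_jacobi_down_step)
  then have "intertwines (jacobi_down \<alpha> (Suc k)) (Jacobi (\<alpha> + real (Suc k)) b) (Jacobi \<alpha> (b + 1 + real k))"
    unfolding eq using Suc by (intro intertwines_mult[where w' = "Jacobi (\<alpha> + real k) (b + 1)"]) simp_all
  moreover have "degree_preserving ?M"
  proof (rule degree_preserving_first_order)
    fix n
    have "complex_of_real (\<alpha> + real (Suc k) + real n) \<noteq> 0"
      unfolding of_real_eq_0_iff using assms by simp
    then show "complex_of_real (\<alpha> + real (Suc k)) + of_nat n * 1 \<noteq> 0" by simp
  qed
  moreover have "jacobi_down \<alpha> k \<noteq> 0" using Suc degree_preserving_nonzero by blast
  ultimately show ?case
    using Suc by (simp only: eq) (simp add: degree_preserving_mult degree_diffop_mult add_ac)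
qed

section \<open>Darboux transformations\<close>

text \<open>
  Write the Darboux factorization as \<open>D = V N\<close> with \<open>p'_n \<cdot> V = A_n p_n\<close>. As \<open>V\<close> preserves degrees,
  \<open>A_n \<noteq> 0\<close>, and dividing \<open>p'_n \<cdot> V N = c p'_n\<close> by \<open>A_n\<close> shows that \<open>N\<close> maps \<open>p_n\<close> to a multiple
  of \<open>p'_n\<close>.
\<close>

lemma intertwiner_if_darboux:
  assumes w: "admissible w" "admissible w'" and "is_darboux_of (weight w) (weight w')"
  shows "\<exists>N\<in>intertwiners w w'. N \<noteq> 0"
proof -
  obtain p p' D V N A where "monic_orthogonal (weight w') p" "monic_orthogonal (weight w) p'"
    and D: "D \<in> scalar_D (weight w')" "D = V \<odot> N"
    and pres: "degree_preserving V" "degree_preserving N"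
    and A: "\<And>n. act (p n) V = smult (A n) (p' n)"
    using assms(3) unfolding is_darboux_of_def by blast
  then have p: "p = eigenpoly w'" "p' = eigenpoly w"
    by (simp_all add: monic_orthogonal_iff w)
  have "N \<in> intertwiners w w'"
    unfolding intertwiners_def
  proof safe
    fix n
    obtain c where c: "act (eigenpoly w' n) D = smult c (eigenpoly w' n)"
      using D(1) scalar_D_eq_intertwiners[OF w(2)] unfolding intertwiners_def by blast
    have "act (eigenpoly w' n) V \<noteq> 0"
      using pres(1) eigenpoly_nonzero[OF w(2)] unfolding degree_preserving_def by blast
    then have "A n \<noteq> 0" using A[of n] p by auto
    moreover have "smult (A n) (act (eigenpoly w n) N) = smult c (eigenpoly w' n)"
      using c A[of n] unfolding D(2) act_diffop_mult p by (simp add: act_smult_left)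
    then have "smult (1 / A n) (smult (A n) (act (eigenpoly w n) N)) = smult (1 / A n) (smult c (eigenpoly w' n))"
      by simp
    ultimately have "act (eigenpoly w n) N = smult (1 / A n * c) (eigenpoly w' n)"
      by simp
    then show "\<exists>c. act (eigenpoly w n) N = smult c (eigenpoly w' n)" ..
  qed
  moreover have "N \<noteq> 0"
    using pres(2) by (rule degree_preserving_nonzero)
  ultimately show ?thesis by blast
qed

lemma darboux_if_intertwiners:
  assumes w: "admissible w" "admissible w'" and supp: "{x. weight w x \<noteq> 0} = {x. weight w' x \<noteq> 0}"
    and V: "V \<in> intertwiners w' w" "degree_preserving V"
    and N: "N \<in> intertwiners w w'" "degree_preserving N"
  shows "is_darboux_of (weight w) (weight w')"
proof -
  have "V \<odot> N \<in> scalar_D (weight w')"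
    using V N by (simp add: scalar_D_eq_intertwiners[OF w(2)] diffop_mult_in_intertwiners)
  moreover have "\<forall>n. \<exists>c. act (eigenpoly w' n) V = smult c (eigenpoly w n)"
    using V(1) by (simp add: intertwiners_def)
  then have "\<exists>A. \<forall>n. act (eigenpoly w' n) V = smult (A n) (eigenpoly w n)"
    by (rule choice)
  ultimately show ?thesis
    unfolding is_darboux_of_def monic_orthogonal_iff[OF w(1)] monic_orthogonal_iff[OF w(2)]
    using supp V(2) N(2) by blast
qed

lemma intertwiners_eq_if_trivial:
  assumes w: "admissible w" "admissible w'" and zero: "\<And>D. D \<in> intertwiners w w' \<Longrightarrow> D = 0"
  shows "intertwiners w w' = {\<T> w w' \<odot> D | D. D \<in> intertwiners w' w'}"
proof -
  have "\<not> is_darboux_of (weight w) (weight w')"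
    using intertwiner_if_darboux[OF w] zero by blast
  then have "\<T> w w' = 0" by (simp add: \<T>_def)
  then show ?thesis using zero zero_in_intertwiners[of w w'] zero_in_intertwiners[of w' w'] by auto
qed

text \<open>
  \<open>V\<close> is the explicit operator in the opposite direction; it certifies that the weights are Darboux
  transformations of each other, so that \<open>\<T>\<close> takes the value given by the formula.
\<close>

lemma intertwiners_eq_if_darboux:
  assumes w: "admissible w" "admissible w'" and ne: "w \<noteq> w'"
    and ev: "eigval w = eigval w'" and q: "pearson_q w = pearson_q w'"
    and supp: "{x. weight w x \<noteq> 0} = {x. weight w' x \<noteq> 0}"
    and T: "intertwines (darboux_formula w w') w w'" "degree_preserving (darboux_formula w w')"
    and V: "intertwines V w' w" "degree_preserving V"
    and par: "\<And>D. D \<in> intertwiners w w' \<Longrightarrow> D \<noteq> 0 \<Longrightarrow> \<exists>i. degree D = degree (darboux_formula w w') + 2 * i"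
  shows "intertwiners w w' = {\<T> w w' \<odot> D | D. D \<in> intertwiners w' w'}"
proof -
  have T_in: "darboux_formula w w' \<in> intertwiners w w'"
    using T(2) by (intro intertwiner_if_intertwines w ev T) (simp add: degree_preserving_def)
  have "V \<in> intertwiners w' w"
    using V(2) by (intro intertwiner_if_intertwines w ev[symmetric] V) (simp add: degree_preserving_def)
  then have "is_darboux_of (weight w) (weight w')"
    using darboux_if_intertwiners[OF w supp] V(2) T_in T(2) by blast
  then have eq: "\<T> w w' = darboux_formula w w'" using ne by (simp add: \<T>_def)
  have nz: "darboux_formula w w' \<noteq> 0"
    using T(2) by (rule degree_preserving_nonzero)
  show ?thesis
    unfolding eq
    using intertwiners_principal[OF w ev q T_in nz par] diffop_mult_in_intertwiners[OF T_in] by blast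
qed

text \<open>
  The degrees of nonzero intertwiners force \<open>\<alpha> - \<alpha>'\<close> to be an integer and have the parity that
  \<open>intertwiners_principal\<close> needs.
\<close>

lemma intertwiners_Laguerre:
  assumes w: "\<alpha> > -1" "\<alpha>' > -1" and ne: "\<alpha> \<noteq> \<alpha>'"
  defines "w \<equiv> Laguerre \<alpha>" and "w' \<equiv> Laguerre \<alpha>'"
  shows "intertwiners w w' = {\<T> w w' \<odot> D | D. D \<in> intertwiners w' w'}"
proof -
  have ok: "admissible w" "admissible w'" "w \<noteq> w'" "eigval w = eigval w'" "pearson_q w = pearson_q w'"
    "{x. weight w x \<noteq> 0} = {x. weight w' x \<noteq> 0}"
    using assms by (auto simp: w_def w'_def fun_eq_iff)
  consider (up) k where "\<alpha>' = \<alpha> + real k" | (down) k where "\<alpha> = \<alpha>' + real k" "\<alpha>' - \<alpha> \<notin> \<nat>"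
    | (none) "\<And>a m::nat. 2 * real a \<noteq> real m + \<alpha> - \<alpha>'"
  proof (cases "\<alpha>' - \<alpha> \<in> \<nat>")
    case True
    then obtain k where "\<alpha>' - \<alpha> = real k" by (auto elim: Nats_cases)
    then show ?thesis using up[of k] by simp
  next
    case not_up: False
    show ?thesis
    proof (cases "\<alpha> - \<alpha>' \<in> \<nat>")
      case True
      then obtain k where "\<alpha> - \<alpha>' = real k" by (auto elim: Nats_cases)
      then show ?thesis using down[of k] not_up by simp
    next
      case False
      have "2 * real a \<noteq> real m + \<alpha> - \<alpha>'" for a m :: nat
      proof
        assume eq: "2 * real a = real m + \<alpha> - \<alpha>'"
        show False
        proof (cases "m \<le> 2 * a")
          case True
          then have "\<alpha> - \<alpha>' = real (2 * a - m)" using eq by simp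
          then show False using False by simp
        next
          case False
          then have "\<alpha>' - \<alpha> = real (m - 2 * a)" using eq by simp
          then show False using not_up by simp
        qed
      qed
      then show ?thesis by (rule none)
    qed
  qed
  then show ?thesis
  proof cases
    case up
    have T: "darboux_formula w w' = laguerre_up k"
      using up by (simp add: w_def w'_def)
    have V: "intertwines (laguerre_down \<alpha> k) w' w" "degree_preserving (laguerre_down \<alpha> k)"
      using laguerre_down_intertwines[OF w(1), of k] up by (simp_all add: w_def w'_def)
    have "\<exists>i. degree D = degree (darboux_formula w w') + 2 * i" if D: "D \<in> intertwiners w w'" "D \<noteq> 0" for D
    proof -
      obtain a where "2 * real a = real (degree D) + \<alpha> - \<alpha>'"
        using intertwiner_degree_Laguerre[of D \<alpha> \<alpha>'] D w by (auto simp: w_def w'_def)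
      then have "real (degree D) = real (k + 2 * a)" using up by simp
      then have "degree D = k + 2 * a" by (simp only: of_nat_eq_iff)
      then show ?thesis unfolding T using laguerre_up_intertwines[of k \<alpha>] by simp
    qed
    then show ?thesis
      using laguerre_up_intertwines[of k \<alpha>] up V T by (intro intertwiners_eq_if_darboux ok) (simp_all add: w_def w'_def)
  next
    case down
    have T: "darboux_formula w w' = laguerre_down \<alpha>' k"
      using down by (simp add: w_def w'_def)
    have V: "intertwines (laguerre_up k) w' w" "degree_preserving (laguerre_up k)"
      using laguerre_up_intertwines[of k \<alpha>'] down by (simp_all add: w_def w'_def)
    have "\<exists>i. degree D = degree (darboux_formula w w') + 2 * i" if D: "D \<in> intertwiners w w'" "D \<noteq> 0" for D
    proof -
      obtain a where a: "a \<le> degree D" "2 * real a = real (degree D) + \<alpha> - \<alpha>'"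
        using intertwiner_degree_Laguerre[of D \<alpha> \<alpha>'] D w by (auto simp: w_def w'_def)
      then have "real (2 * a) = real (degree D + k)" using down by simp
      then have "2 * a = degree D + k" by (simp only: of_nat_eq_iff)
      \<comment> \<open>The bound \<open>a \<le> degree D\<close> gives \<open>k \<le> a\<close>, so the truncated subtraction is exact.\<close>
      then have "degree D = k + 2 * (a - k)" using a(1) by simp
      then show ?thesis unfolding T using laguerre_down_intertwines[OF w(2), of k] by simp
    qed
    then show ?thesis
      using laguerre_down_intertwines[OF w(2), of k] down V T by (intro intertwiners_eq_if_darboux ok) (simp_all add: w_def w'_def)
  next
    case none
    have "D = 0" if "D \<in> intertwiners w w'" for D
      using intertwiner_degree_Laguerre[of D \<alpha> \<alpha>'] that none w unfolding w_def w'_def by blast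
    then show ?thesis by (intro intertwiners_eq_if_trivial ok)
  qed
qed

text \<open>
  If \<open>\<alpha> + \<beta> = \<alpha>' + \<beta>'\<close>, the orders of vanishing at \<open>1\<close> and \<open>-1\<close> force \<open>\<alpha> - \<alpha>'\<close> to be an integer and give
  the parity that \<open>intertwiners_principal\<close> needs.
\<close>

lemma intertwiners_Jacobi:
  assumes w: "\<alpha> > -1" "\<beta> > -1" "\<alpha>' > -1" "\<beta>' > -1" and ne: "Jacobi \<alpha> \<beta> \<noteq> Jacobi \<alpha>' \<beta>'"
  defines "w \<equiv> Jacobi \<alpha> \<beta>" and "w' \<equiv> Jacobi \<alpha>' \<beta>'"
  shows "intertwiners w w' = {\<T> w w' \<odot> D | D. D \<in> intertwiners w' w'}"
proof (cases "\<alpha> + \<beta> = \<alpha>' + \<beta>'")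
  case False
  have ok: "admissible w" "admissible w'" using w by (simp_all add: w_def w'_def)
  show ?thesis
    using intertwiner_Jacobi_zero[of \<alpha> \<beta> \<alpha>' \<beta>'] ok False
    by (intro intertwiners_eq_if_trivial ok) (simp add: w_def w'_def)
next
  case sum: True
  have ok: "admissible w" "admissible w'" "w \<noteq> w'" "eigval w = eigval w'" "pearson_q w = pearson_q w'"
    "{x. weight w x \<noteq> 0} = {x. weight w' x \<noteq> 0}"
    using assms sum by (auto simp: w_def w'_def fun_eq_iff add.assoc)
  note degs = intertwiner_degree_Jacobi[of _ \<alpha> \<beta> \<alpha>' \<beta>', folded w_def w'_def, OF _ _ ok(1,2) sum]
  consider (up) k where "\<alpha>' = \<alpha> + real k" | (down) k where "\<alpha> = \<alpha>' + real k" "\<alpha>' - \<alpha> \<notin> \<nat>"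
    | (none) "\<And>a b::nat. real a - real b \<noteq> \<alpha>' - \<alpha>"
  proof (cases "\<alpha>' - \<alpha> \<in> \<nat>")
    case True
    then obtain k where "\<alpha>' - \<alpha> = real k" by (auto elim: Nats_cases)
    then show ?thesis using up[of k] by simp
  next
    case not_up: False
    show ?thesis
    proof (cases "\<alpha> - \<alpha>' \<in> \<nat>")
      case True
      then obtain k where "\<alpha> - \<alpha>' = real k" by (auto elim: Nats_cases)
      then show ?thesis using down[of k] not_up by simp
    next
      case False
      have "real a - real b \<noteq> \<alpha>' - \<alpha>" for a b :: nat
      proof
        assume eq: "real a - real b = \<alpha>' - \<alpha>"
        show False
        proof (cases "b \<le> a")
          case True
          then have "\<alpha>' - \<alpha> = real (a - b)" using eq by simp
          then show False using not_up by simp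
        next
          case b: False
          then have "\<alpha> - \<alpha>' = real (b - a)" using eq by simp
          then show False using False by simp
        qed
      qed
      then show ?thesis by (rule none)
    qed
  qed
  then show ?thesis
  proof cases
    case up
    then have \<beta>: "\<beta> = \<beta>' + real k" using sum by simp
    have T: "darboux_formula w w' = jacobi_up \<beta>' k"
      using up \<beta> by (simp add: w_def w'_def)
    have V: "intertwines (jacobi_down \<alpha> k) w' w" "degree_preserving (jacobi_down \<alpha> k)"
      using jacobi_down_intertwines[OF w(1), of k \<beta>'] up \<beta> by (simp_all add: w_def w'_def)
    have "\<exists>i. degree D = degree (darboux_formula w w') + 2 * i" if D: "D \<in> intertwiners w w'" "D \<noteq> 0" for D
    proof -
      obtain a where "2 * real a = real (degree D) - (\<alpha>' - \<alpha>)" using degs[OF D] by blast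
      then have "real (degree D) = real (k + 2 * a)" using up by simp
      then have "degree D = k + 2 * a" by (simp only: of_nat_eq_iff)
      then show ?thesis unfolding T using jacobi_up_intertwines[OF w(4), of k \<alpha>] by simp
    qed
    then show ?thesis
      using jacobi_up_intertwines[OF w(4), of k \<alpha>] up \<beta> V T by (intro intertwiners_eq_if_darboux ok) (simp_all add: w_def w'_def)
  next
    case down
    then have \<beta>: "\<beta>' = \<beta> + real k" using sum by simp
    have T: "darboux_formula w w' = jacobi_down \<alpha>' k"
      using down \<beta> by (simp add: w_def w'_def)
    have V: "intertwines (jacobi_up \<beta> k) w' w" "degree_preserving (jacobi_up \<beta> k)"
      using jacobi_up_intertwines[OF w(2), of k \<alpha>'] down \<beta> by (simp_all add: w_def w'_def)
    have "\<exists>i. degree D = degree (darboux_formula w w') + 2 * i" if D: "D \<in> intertwiners w w'" "D \<noteq> 0" for D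
    proof -
      obtain b where "2 * real b = real (degree D) + (\<alpha>' - \<alpha>)" using degs[OF D] by blast
      then have "real (degree D) = real (k + 2 * b)" using down by simp
      then have "degree D = k + 2 * b" by (simp only: of_nat_eq_iff)
      then show ?thesis unfolding T using jacobi_down_intertwines[OF w(3), of k \<beta>] by simp
    qed
    then show ?thesis
      using jacobi_down_intertwines[OF w(3), of k \<beta>] down \<beta> V T by (intro intertwiners_eq_if_darboux ok) (simp_all add: w_def w'_def)
  next
    case none
    have "D = 0" if D: "D \<in> intertwiners w w'" for D
    proof (rule ccontr)
      assume "D \<noteq> 0"
      then obtain a b where "2 * real a = real (degree D) - (\<alpha>' - \<alpha>)" "2 * real b = real (degree D) + (\<alpha>' - \<alpha>)"
        using degs[OF D] by blast
      then have "real b - real a = \<alpha>' - \<alpha>" by simp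
      then show False using none by blast
    qed
    then show ?thesis by (intro intertwiners_eq_if_trivial ok)
  qed
qed

theorem intertwiners_eq:
  assumes w: "admissible w" "admissible w'"
    and type: "is_Hermite w \<and> is_Hermite w' \<or> is_Laguerre w \<and> is_Laguerre w' \<or> is_Jacobi w \<and> is_Jacobi w'"
  shows "intertwiners w w' = {\<T> w w' \<odot> D | D. D \<in> intertwiners w' w'}"
proof (cases "w = w'")
  case True
  have "is_darboux_of (weight w') (weight w')"
    using w(2) one_in_intertwiners[of w'] degree_preserving_one
    by (intro darboux_if_intertwiners[where V = 1 and N = 1]) auto
  then show ?thesis using True by (simp add: \<T>_def)
next
  case False
  show ?thesis
  proof (cases w)
    case (Hermite b)
    then obtain b' where "w' = Hermite b'" using type by (cases w') auto
    then show ?thesis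
      using False Hermite nonzero_intertwiner_Hermite_imp_eq w by (intro intertwiners_eq_if_trivial) auto
  next
    case (Laguerre \<alpha>)
    then obtain \<alpha>' where "w' = Laguerre \<alpha>'" using type by (cases w') auto
    then show ?thesis using intertwiners_Laguerre[of \<alpha> \<alpha>'] Laguerre False w by auto
  next
    case (Jacobi \<alpha> \<beta>)
    then obtain \<alpha>' \<beta>' where "w' = Jacobi \<alpha>' \<beta>'" using type by (cases w') auto
    then show ?thesis using intertwiners_Jacobi[of \<alpha> \<beta> \<alpha>' \<beta>'] Jacobi False w by auto
  qed
qed

section \<open>Diagonal matrix weights\<close>

definition entry_op :: "'n::finite matdiffop \<Rightarrow> 'n \<Rightarrow> 'n \<Rightarrow> diffop" where
  "entry_op D i j = map_poly (\<lambda>M. M $ i $ j) D"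

lemma coeff_entry_op: "coeff (entry_op D i j) k = coeff D k $ i $ j"
  by (simp add: entry_op_def coeff_map_poly)

lemma coeff_matrix_unit_op:
  "coeff (matrix_unit_op D i j) k $ a $ b = (if a = i \<and> b = j then coeff D k else 0)"
  unfolding matrix_unit_op_def by (subst coeff_map_poly) (simp_all add: vec_eq_iff)

lemma matdiffop_eqI: "(\<And>i j. entry_op D i j = entry_op D' i j) \<Longrightarrow> D = D'"
  by (simp add: poly_eq_iff vec_eq_iff flip: coeff_entry_op)

lemma entry_op_sum_matrix_units:
  "entry_op (\<Sum>i\<in>UNIV. \<Sum>j\<in>UNIV. matrix_unit_op (F i j) i j) a b = F a b"
proof (rule poly_eqI)
  fix k
  have "coeff (entry_op (\<Sum>i\<in>UNIV. \<Sum>j\<in>UNIV. matrix_unit_op (F i j) i j) a b) k =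
     (\<Sum>i\<in>UNIV. \<Sum>j\<in>UNIV. if a = i then if b = j then coeff (F i j) k else 0 else 0)"
    by (simp add: coeff_entry_op coeff_sum coeff_matrix_unit_op if_if_eq_conj conj_commute)
  also have "\<dots> = (\<Sum>i\<in>UNIV. if a = i then coeff (F i b) k else 0)"
    by (intro sum.cong) (auto simp: sum.delta)
  finally show "coeff (entry_op (\<Sum>i\<in>UNIV. \<Sum>j\<in>UNIV. matrix_unit_op (F i j) i j) a b) k = coeff (F a b) k"
    by (simp add: sum.delta)
qed

lemma matrix_eq_sum_axis:
  "(M :: complex ^ 'n ^ 'n) = (\<Sum>i\<in>UNIV. \<Sum>j\<in>UNIV. axis i (axis j (M $ i $ j)))"
proof -
  have "(\<Sum>i\<in>UNIV. \<Sum>j\<in>UNIV. axis i (axis j (M $ i $ j))) $ a $ b = M $ a $ b" for a b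
  proof -
    have "(\<Sum>i\<in>UNIV. \<Sum>j\<in>UNIV. axis i (axis j (M $ i $ j))) $ a $ b =
        (\<Sum>i\<in>UNIV. \<Sum>j\<in>UNIV. if a = i then if b = j then M $ i $ j else 0 else 0)"
      by (auto simp: axis_def intro!: sum.cong)
    also have "\<dots> = (\<Sum>i\<in>UNIV. if a = i then M $ i $ b else 0)"
      by (intro sum.cong) (auto simp: sum.delta)
    finally show ?thesis by (simp add: sum.delta)
  qed
  then show ?thesis by (simp add: vec_eq_iff)
qed

lemma integrable_matrix:
  fixes f :: "'a \<Rightarrow> complex ^ 'n ^ 'n"
  assumes "\<And>i j. integrable M (\<lambda>x. f x $ i $ j)"
  shows "integrable M f"
proof -
  have bl: "bounded_linear (\<lambda>c::complex. axis i (axis j c) :: complex ^ 'n ^ 'n)" for i j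
    by (intro linear_conv_bounded_linear[THEN iffD1] linearI)
      (simp_all add: vec_eq_iff axis_def)
  have "integrable M (\<lambda>x. \<Sum>i\<in>UNIV. \<Sum>j\<in>UNIV. axis i (axis j (f x $ i $ j)) :: complex ^ 'n ^ 'n)"
    by (intro Bochner_Integration.integrable_sum integrable_bounded_linear[OF bl] assms)
  then show ?thesis by (simp flip: matrix_eq_sum_axis)
qed

lemma integral_matrix_entry:
  fixes f :: "'a \<Rightarrow> complex ^ 'n ^ 'n"
  assumes "\<And>i j. integrable M (\<lambda>x. f x $ i $ j)"
  shows "integral\<^sup>L M f $ i $ j = (LINT x|M. f x $ i $ j)"
proof -
  have "bounded_linear (\<lambda>A::complex ^ 'n ^ 'n. A $ i $ j)"
    using bounded_linear_compose[OF bounded_linear_vec_nth bounded_linear_vec_nth] .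
  then show ?thesis using integrable_matrix[OF assms] by (rule integral_bounded_linear [symmetric])
qed

context
  fixes w :: "'n::finite \<Rightarrow> classical_weight"
  assumes w: "\<And>i. admissible (w i)"
begin

lemma mat_inner_entry:
  "mat_inner (direct_sum_weight (\<lambda>i. weight (w i))) P Q $ i $ j = vector_inner w (\<lambda>k. P $ i $ k) (\<lambda>k. Q $ j $ k)"
proof -
  let ?W = "direct_sum_weight (\<lambda>i. weight (w i))"
  let ?f = "\<lambda>x. mat_eval P x ** ?W x ** adjoint_matrix (mat_eval Q x)"
  have entry: "?f x $ i $ j = (\<Sum>k\<in>UNIV. poly (P $ i $ k) (of_real x) * of_real (weight (w k) x) * cnj (poly (Q $ j $ k) (of_real x)))" for x i j
    by (simp add: matrix_matrix_mult_def direct_sum_weight_def mat_eval_def adjoint_matrix_def map_matrix_def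
        transpose_def if_distrib sum.delta sum_distrib_right cong: if_cong)
  have int: "integrable lborel (\<lambda>x. poly (P $ i $ k) (complex_of_real x) * of_real (weight (w k) x) * cnj (poly (Q $ j $ k) (of_real x)))" for i j k
    using integrable_poly_weight[OF w, of "P $ i $ k * map_poly cnj (Q $ j $ k)" k] by (simp add: mult_ac)
  have "mat_inner ?W P Q $ i $ j = (LINT x|lborel. ?f x $ i $ j)"
    unfolding mat_inner_def
  proof (rule integral_matrix_entry)
    show "integrable lborel (\<lambda>x. ?f x $ i $ j)" for i j
      unfolding entry by (intro Bochner_Integration.integrable_sum int)
  qed
  also have "\<dots> = (\<Sum>k\<in>UNIV. scalar_inner (weight (w k)) (P $ i $ k) (Q $ j $ k))"
    unfolding entry scalar_inner_def by (intro Bochner_Integration.integral_sum int)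
  finally show ?thesis by (simp add: vector_inner_def)
qed

lemma mat_monic_iff:
  "mat_monic n P \<longleftrightarrow> (\<forall>i j. degree (P $ i $ j) \<le> n \<and> coeff (P $ i $ j) n = (if i = j then 1 else 0))"
proof -
  have "(\<forall>k>n. mat_coeff P k = 0) \<longleftrightarrow> (\<forall>i j. degree (P $ i $ j) \<le> n)"
  proof -
    have "degree p \<le> n \<longleftrightarrow> (\<forall>k>n. coeff p k = 0)" for p :: "complex poly"
      by (meson coeff_eq_0 degree_le le_less_trans)
    then show ?thesis by (auto simp: mat_coeff_def map_matrix_def vec_eq_iff)
  qed
  moreover have "mat_coeff P n = mat 1 \<longleftrightarrow> (\<forall>i j. coeff (P $ i $ j) n = (if i = j then 1 else 0))"
    by (simp add: mat_coeff_def map_matrix_def vec_eq_iff mat_def)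
  ultimately show ?thesis unfolding mat_monic_def by blast
qed

lemma mat_monic_orthogonal_iff:
  "mat_monic_orthogonal (direct_sum_weight (\<lambda>i. weight (w i))) P \<longleftrightarrow>
     P = (\<lambda>n. \<chi> i j. if i = j then eigenpoly (w i) n else 0)" (is "?L \<longleftrightarrow> P = ?E")
proof
  assume L: ?L
  have "P n $ i $ j = (if i = j then eigenpoly (w i) n else 0)" for n i j
  proof (rule vector_orthogonal_unique[OF w, of "\<lambda>n i j. P n $ i $ j"])
    show "vector_inner w (\<lambda>j. P m $ i $ j) (\<lambda>k. P n $ j $ k) = 0" if "m \<noteq> n" for m n i j
      using L that unfolding mat_monic_orthogonal_def by (simp flip: mat_inner_entry)
  qed (use L in \<open>simp_all add: mat_monic_orthogonal_def mat_monic_iff\<close>)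
  then show "P = ?E" by (intro ext) (simp add: vec_eq_iff)
next
  assume P: "P = ?E"
  have "vector_inner w (\<lambda>k. ?E m $ i $ k) (\<lambda>k. ?E n $ j $ k) = 0" if "m \<noteq> n" for m n i j
    unfolding vector_inner_def
    by (intro sum.neutral) (auto simp: scalar_inner_eigenpoly[OF w that] scalar_inner_zero_left[OF w] scalar_inner_zero_right[OF w])
  then have "mat_inner (direct_sum_weight (\<lambda>i. weight (w i))) (?E m) (?E n) = 0" if "m \<noteq> n" for m n
    using that by (simp add: vec_eq_iff mat_inner_entry)
  then show ?L
    unfolding P mat_monic_orthogonal_def
    by (simp add: mat_monic_iff degree_eigenpoly[OF w] coeff_eigenpoly[OF w])
qed

lemma mat_act_diagonal_entry:
  "mat_act (\<chi> i j. if i = j then p i else 0) D $ i $ j = act (p i) (entry_op D i j)"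
proof -
  have pd: "(map_matrix pderiv ^^ k) (\<chi> i j. if i = j then p i else 0) = (\<chi> i j. if i = j then (pderiv ^^ k) (p i) else 0)" for k
    by (induction k) (auto simp: map_matrix_def vec_eq_iff)
  have "degree (entry_op D i j) \<le> degree D"
    by (intro degree_le) (simp add: coeff_entry_op coeff_eq_0)
  then have "act (p i) (entry_op D i j) = (\<Sum>k\<le>degree D. (pderiv ^^ k) (p i) * coeff D k $ i $ j)"
    by (simp add: act_bound coeff_entry_op)
  also have "\<dots> = mat_act (\<chi> i j. if i = j then p i else 0) D $ i $ j"
    unfolding mat_act_def pd
    by (simp add: matrix_matrix_mult_def if_distrib[of "\<lambda>x. x * _"] sum.delta cong: if_cong)
  finally show ?thesis ..
qed

text \<open>
  Since \<open>P_n\<close> is diagonal, the equation \<open>P_n \<cdot> D = \<Lambda>_n P_n\<close> splits into its entries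
  \<open>p_n \<cdot> D_{i,j} = (\<Lambda>_n)_{i,j} p'_n\<close>, where \<open>p_n\<close> and \<open>p'_n\<close> belong to \<open>w_i\<close> and \<open>w_j\<close>.
\<close>

theorem mat_D_iff:
  "D \<in> mat_D (direct_sum_weight (\<lambda>i. weight (w i))) \<longleftrightarrow> (\<forall>i j. entry_op D i j \<in> intertwiners (w i) (w j))"
proof -
  let ?E = "\<lambda>n. (\<chi> i j. if i = j then eigenpoly (w i) n else 0) :: 'n matpoly"
  have rhs: "(mat_const L ** ?E n) $ i $ j = smult (L $ i $ j) (eigenpoly (w j) n)" for L n i j
    by (simp add: mat_const_def map_matrix_def matrix_matrix_mult_def if_distrib[of "\<lambda>x. _ * x"] sum.delta' cong: if_cong)
  have "D \<in> mat_D (direct_sum_weight (\<lambda>i. weight (w i))) \<longleftrightarrow> (\<forall>n. \<exists>L. mat_act (?E n) D = mat_const L ** ?E n)"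
    by (simp add: mat_D_def mat_monic_orthogonal_iff)
  also have "\<dots> \<longleftrightarrow> (\<forall>n. \<exists>L. \<forall>i j. act (eigenpoly (w i) n) (entry_op D i j) = smult (L $ i $ j) (eigenpoly (w j) n))"
    by (simp add: vec_eq_iff rhs mat_act_diagonal_entry)
  also have "\<dots> \<longleftrightarrow> (\<forall>n i j. \<exists>c. act (eigenpoly (w i) n) (entry_op D i j) = smult c (eigenpoly (w j) n))"
  proof (intro iff_allI iffI)
    fix n
    assume "\<forall>i j. \<exists>c. act (eigenpoly (w i) n) (entry_op D i j) = smult c (eigenpoly (w j) n)"
    then obtain c where "\<And>i j. act (eigenpoly (w i) n) (entry_op D i j) = smult (c i j) (eigenpoly (w j) n)"
      by metis
    then show "\<exists>L. \<forall>i j. act (eigenpoly (w i) n) (entry_op D i j) = smult (L $ i $ j) (eigenpoly (w j) n)"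
      by (intro exI[of _ "\<chi> i j. c i j"]) simp
  qed blast
  also have "\<dots> \<longleftrightarrow> (\<forall>i j. entry_op D i j \<in> intertwiners (w i) (w j))"
    by (auto simp: intertwiners_def)
  finally show ?thesis .
qed

end

lemma mem_double_sum_of_images:
  fixes f :: "'i::finite \<Rightarrow> 'j::finite \<Rightarrow> 'a \<Rightarrow> 'b::comm_monoid_add"
  shows "x \<in> (\<Sum>i\<in>UNIV. \<Sum>j\<in>UNIV. f i j ` A i j) \<longleftrightarrow>
    (\<exists>F. (\<forall>i j. F i j \<in> A i j) \<and> x = (\<Sum>i\<in>UNIV. \<Sum>j\<in>UNIV. f i j (F i j)))" (is "_ \<longleftrightarrow> ?R")
proof -
  have "x \<in> (\<Sum>i\<in>UNIV. \<Sum>j\<in>UNIV. f i j ` A i j) \<longleftrightarrow>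
    (\<exists>t. x = sum t UNIV \<and> (\<forall>i. \<exists>s. t i = sum s UNIV \<and> (\<forall>j. s j \<in> f i j ` A i j)))"
    by (simp add: set_sum_alt)
  also have "\<dots> \<longleftrightarrow> ?R"
  proof
    assume "\<exists>t. x = sum t UNIV \<and> (\<forall>i. \<exists>s. t i = sum s UNIV \<and> (\<forall>j. s j \<in> f i j ` A i j))"
    then obtain t where x: "x = sum t UNIV"
      and t: "\<forall>i. \<exists>s. t i = sum s UNIV \<and> (\<forall>j. s j \<in> f i j ` A i j)" by blast
    from choice[OF t] obtain s where s: "\<forall>i. t i = sum (s i) UNIV \<and> (\<forall>j. s i j \<in> f i j ` A i j)" ..
    define F where "F = (\<lambda>i j. SOME a. a \<in> A i j \<and> s i j = f i j a)"
    have F: "F i j \<in> A i j \<and> s i j = f i j (F i j)" for i j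
    proof -
      have "\<exists>a. a \<in> A i j \<and> s i j = f i j a" using s by blast
      then show ?thesis unfolding F_def by (rule someI_ex)
    qed
    have "x = (\<Sum>i\<in>UNIV. \<Sum>j\<in>UNIV. f i j (F i j))"
      unfolding x using s F by (intro sum.cong refl) (metis (no_types, lifting) sum.cong)
    then show ?R using F by blast
  next
    assume ?R
    then obtain F where "\<forall>i j. F i j \<in> A i j" "x = (\<Sum>i\<in>UNIV. \<Sum>j\<in>UNIV. f i j (F i j))" by blast
    then show "\<exists>t. x = sum t UNIV \<and> (\<forall>i. \<exists>s. t i = sum s UNIV \<and> (\<forall>j. s j \<in> f i j ` A i j))"
      by (intro exI[of _ "\<lambda>i. \<Sum>j\<in>UNIV. f i j (F i j)"] conjI allI exI[of _ "\<lambda>j. f _ j (F _ j)"]) auto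
  qed
  finally show ?thesis .
qed

theorem theorem6p7:
  fixes w :: "'n::finite \<Rightarrow> classical_weight"
  assumes "\<And>i. admissible (w i)"
    and "(\<forall>i. is_Hermite (w i)) \<or> (\<forall>i. is_Laguerre (w i)) \<or> (\<forall>i. is_Jacobi (w i))"
  shows "mat_D (direct_sum_weight (\<lambda>i. weight (w i))) =
    (\<Sum>i\<in>UNIV. \<Sum>j\<in>UNIV.
      {matrix_unit_op (\<T> (w i) (w j) \<odot> D) i j | D. D \<in> scalar_D (weight (w j))})"
proof (rule set_eqI)
  fix X :: "'n matdiffop"
  have I: "intertwiners (w i) (w j) = {\<T> (w i) (w j) \<odot> D | D. D \<in> scalar_D (weight (w j))}" for i j
    unfolding scalar_D_eq_intertwiners[OF assms(1)]
    using assms(2) by (intro intertwiners_eq assms(1)) auto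
  have S: "{matrix_unit_op (\<T> (w i) (w j) \<odot> D) i j | D. D \<in> scalar_D (weight (w j))} =
      (\<lambda>D. matrix_unit_op D i j) ` intertwiners (w i) (w j)" for i j
    unfolding I by blast
  have "X \<in> mat_D (direct_sum_weight (\<lambda>i. weight (w i))) \<longleftrightarrow> (\<forall>i j. entry_op X i j \<in> intertwiners (w i) (w j))"
    by (rule mat_D_iff[OF assms(1)])
  also have "\<dots> \<longleftrightarrow> (\<exists>F. (\<forall>i j. F i j \<in> intertwiners (w i) (w j)) \<and>
      X = (\<Sum>i\<in>UNIV. \<Sum>j\<in>UNIV. matrix_unit_op (F i j) i j))"
  proof
    assume "\<forall>i j. entry_op X i j \<in> intertwiners (w i) (w j)"
    moreover have "X = (\<Sum>i\<in>UNIV. \<Sum>j\<in>UNIV. matrix_unit_op (entry_op X i j) i j)"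
      by (rule matdiffop_eqI) (simp only: entry_op_sum_matrix_units)
    ultimately show "\<exists>F. (\<forall>i j. F i j \<in> intertwiners (w i) (w j)) \<and>
        X = (\<Sum>i\<in>UNIV. \<Sum>j\<in>UNIV. matrix_unit_op (F i j) i j)"
      by blast
  qed (auto simp: entry_op_sum_matrix_units)
  also have "\<dots> \<longleftrightarrow> X \<in> (\<Sum>i\<in>UNIV. \<Sum>j\<in>UNIV. (\<lambda>D. matrix_unit_op D i j) ` intertwiners (w i) (w j))"
    by (rule mem_double_sum_of_images [symmetric])
  finally show "X \<in> mat_D (direct_sum_weight (\<lambda>i. weight (w i))) \<longleftrightarrow>
      X \<in> (\<Sum>i\<in>UNIV. \<Sum>j\<in>UNIV. {matrix_unit_op (\<T> (w i) (w j) \<odot> D) i j | D. D \<in> scalar_D (weight (w j))})"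
    unfolding S .
qed

end
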